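(* Let $\mathcal{G}_n=\{\pm e_a : a\in\mathbb{Z}_2^n\}$ be the quasigroup given by the unital basis of the Cayley algebra, with product controlled by a 2-cochain $F:\mathbb{Z}_2^n\times\mathbb{Z}_2^n\to k^*$, and let $B=k[\mathcal{G}_n]$ be the algebra of functions on $\mathcal{G}_n$, with delta functions $f_a^i$ ($a\in\mathbb{Z}_2^n$, $i\in\mathbb{Z}_2$), equipped with $$\Delta_B(f_a^i)=\sum_{b+c=a,\ j+k=i}F(b,c)\,f_b^j\otimes f_c^k,\qquad \epsilon_B(f_a^i)=\delta_{a,0}\delta_{i,0},\qquad S_B(f_a^i)=F(a,a)f_a^i .$$ These structures make $k[\mathcal{G}_n]$ a Hopf coquasigroup. Let $\pi:k[\mathcal{G}_n]\to k[\mathcal{G}_0]$ be the canonical projection given by pull back along the inclusion $\{-e_0,e_0\}\subseteq\mathcal{G}_n$. Then $(k[\mathcal{G}_0],k[\mathcal{G}_n],\pi)$ is quasi coassociative.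
   Context: **Quasigroup.** A set $G$ with a product and identity such that every $g\in G$ has an inverse $g^{-1}\in G$ with $g^{-1}(gh)=h$ and $(hg^{-1})g=h$ for all $h\in G$. **Cayley algebra basis.** $k$ is the ground field. The Cayley algebra has a basis $\{e_a\}_{a\in\mathbb{Z}_2^n}$ with unit $e_0$ and product $e_ae_b=F(a,b)e_{a+b}$, where $F:\mathbb{Z}_2^n\times\mathbb{Z}_2^n\to k^*$ is a 2-cochain with $F(a,0)=F(0,a)=1$ (for $n=1,2,3$ one gets $\mathbb{C},\mathbb{H},\mathbb{O}$). Write $e_a^0:=e_a$ and $e_a^1:=-e_a$, so $\mathcal{G}_n=\{e_a^i: a\in\mathbb{Z}_2^n,\ i\in\mathbb{Z}_2\}$ and $e_a^ie_b^j=F(a,b)e_{a+b}^{i+j}$. This is a quasigroup. **The algebra $k[\mathcal{G}_n]$.** $f_a^i$ is the delta function on $\mathcal{G}_n$ with $f_a^i(e_b^j)=\delta_{a,b}\delta_{i,j}$. The algebra $k[\mathcal{G}_n]$ is generated by the $f_a^i$ with $f_a^if_{a'}^{i'}=f_a^i$ if $a=a'$ and $i=i'$, and $0$ otherwise; its unit is $\sum_{a,i}f_a^i$. The case $n=0$ gives $k[\mathcal{G}_0]$, spanned by $f_0^0,f_0^1$. **Hopf coquasigroup.** A unital associative algebra $H$ with counital algebra homomorphisms $\Delta:H\to H\otimes H$ (not necessarily coassociative) and $\epsilon:H\to k$, and a linear map $S_H:H\to H$ such that, writing $\Delta(h)=h_{(1)}\otimes h_{(2)}$, $(\Delta\otimes\mathrm{id})\Delta(h)=h_{(1)(1)}\otimes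 h_{(1)(2)}\otimes h_{(2)}$, $(\mathrm{id}\otimes\Delta)\Delta(h)=h_{(1)}\otimes h_{(2)(1)}\otimes h_{(2)(2)}$, etc.: $S_H(h_{(1)})h_{(2)(1)}\otimes h_{(2)(2)}=1\otimes h=h_{(1)}S_H(h_{(2)(1)})\otimes h_{(2)(2)}$ and $h_{(1)(1)}\otimes S_H(h_{(1)(2)})h_{(2)}=h\otimes 1=h_{(1)(1)}\otimes h_{(1)(2)}S_H(h_{(2)})$. A morphism of Hopf coquasigroups is an algebra map compatible with coproducts and counits. A Hopf algebra is a coassociative Hopf coquasigroup. **Comultiplicative coassociator** of a Hopf coquasigroup $B$: the linear map $\beta:B\to B\otimes B\otimes B$, $\beta(b)=b_{(1)(1)}S_B(b_{(2)})_{(1)(1)}\otimes b_{(1)(2)(1)}S_B(b_{(2)})_{(1)(2)}\otimes b_{(1)(2)(2)}S_B(b_{(2)})_{(2)}$. **Coassociative pair** $(C,B,\phi)$: a Hopf coquasigroup $B$, a Hopf algebra $C$ and a Hopf coquasigroup morphism $\phi:B\to C$ such that, for all $b\in B$, the elements $(\Delta_B\otimes\mathrm{id})\Delta_B(b)$ and $(\mathrm{id}\otimes\Delta_B)\Delta_B(b)$ become equal after applying $\phi$ to the first tensor leg, and likewise for the second leg, and likewise for the third leg. **Quasi coassociative.** A coassociative pair $(C,B,\phi)$ is quasi coassociative if (1) $\phi$ is a surjective morphism of Hopf coquasigroups; (2) for all $i\in I_B:=\ker\phi$: $i_{(1)(1)}S_B(i_{(2)})\otimes i_{(1)(2)}\in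 B\otimes I_B$ and $i_{(1)}S_B(i_{(2)(2)})\otimes i_{(2)(1)}\in B\otimes I_B$; (3) $I_B\subseteq\ker\beta$.
   Formalization: In the coproduct and antipode, F(b,c)=±1 acts as a sign on delta functions by moving the support (−f_a^i means f_a^{i+1}), not as a scalar; with scalars the coproduct is not multiplicative (n=1, F(1,1)=−1). The field has characteristic other than 2. *)

theory Defs
  imports Complex_Main "HOL-Library.Z2" "HOL-Library.Function_Algebras"
begin

section \<open>Vector spaces and tensor products\<close>

text \<open>
  A vector space over a field is a subspace of an ambient vector space whose addition is the
  one of the type class; the carrier and the scalar multiplication are recorded explicitly.
\<close>

record ('k, 'v) vspace =
  car :: "'v set"
  scl :: "'k \<Rightarrow> 'v \<Rightarrow> 'v"

definition is_vspace :: "('k::field, 'v::ab_group_add, 'm) vspace_scheme \<Rightarrow> bool" where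
  "is_vspace V \<longleftrightarrow> vector_space (scl V) \<and> module.subspace (scl V) (car V)"

definition ground :: "('k::field, 'k) vspace" where
  "ground = \<lparr>car = UNIV, scl = (*)\<rparr>"

definition linear_map ::
  "('k::field, 'v::ab_group_add, 'm) vspace_scheme \<Rightarrow> ('k, 'w::ab_group_add, 'p) vspace_scheme
    \<Rightarrow> ('v \<Rightarrow> 'w) \<Rightarrow> bool" where
  "linear_map V W f \<longleftrightarrow>
     (\<forall>x\<in>car V. f x \<in> car W) \<and>
     (\<forall>x\<in>car V. \<forall>y\<in>car V. f (x + y) = f x + f y) \<and>
     (\<forall>c. \<forall>x\<in>car V. f (scl V c x) = scl W c (f x))"

definition bilinear_map ::
  "('k::field, 'u::ab_group_add, 'm) vspace_scheme \<Rightarrow> ('k, 'v::ab_group_add, 'p) vspace_scheme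
    \<Rightarrow> ('k, 'w::ab_group_add, 'q) vspace_scheme \<Rightarrow> ('u \<Rightarrow> 'v \<Rightarrow> 'w) \<Rightarrow> bool" where
  "bilinear_map U V W f \<longleftrightarrow>
     (\<forall>u\<in>car U. linear_map V W (f u)) \<and>
     (\<forall>v\<in>car V. linear_map U W (\<lambda>u. f u v))"

definition trilinear_form ::
  "('k::field, 'u::ab_group_add, 'm) vspace_scheme \<Rightarrow> ('k, 'v::ab_group_add, 'p) vspace_scheme
    \<Rightarrow> ('k, 'w::ab_group_add, 'q) vspace_scheme \<Rightarrow> ('u \<Rightarrow> 'v \<Rightarrow> 'w \<Rightarrow> 'k) \<Rightarrow> bool" where
  "trilinear_form U V W f \<longleftrightarrow>
     (\<forall>u\<in>car U. \<forall>v\<in>car V. linear_map W ground (\<lambda>w. f u v w)) \<and>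
     (\<forall>u\<in>car U. \<forall>w\<in>car W. linear_map V ground (\<lambda>v. f u v w)) \<and>
     (\<forall>v\<in>car V. \<forall>w\<in>car W. linear_map U ground (\<lambda>u. f u v w))"

text \<open>
  The tensor product of \<open>U\<close> and \<open>V\<close> is realised inside the dual of the space of bilinear forms on
  \<open>U \<times> V\<close>: the pure tensor \<open>u \<otimes> v\<close> is evaluation at \<open>(u, v)\<close>, and the tensor product is the linear
  span of the pure tensors (its universal property is \<open>tensor_universal\<close> below). Forms need only
  be bilinear on the carriers; on all other functions a tensor takes the value \<open>0\<close>. Likewise with
  trilinear forms for threefold tensor products.
\<close>

type_synonym ('k, 'u, 'v) tensor2 = "('u \<Rightarrow> 'v \<Rightarrow> 'k) \<Rightarrow> 'k"
type_synonym ('k, 'u, 'v, 'w) tensor3 = "('u \<Rightarrow> 'v \<Rightarrow> 'w \<Rightarrow> 'k) \<Rightarrow> 'k"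

definition ten2 ::
  "('k::field, 'u::ab_group_add, 'm) vspace_scheme \<Rightarrow> ('k, 'v::ab_group_add, 'p) vspace_scheme
    \<Rightarrow> 'u \<Rightarrow> 'v \<Rightarrow> ('k, 'u, 'v) tensor2" where
  "ten2 U V u v = (\<lambda>f. if bilinear_map U V ground f then f u v else 0)"

definition ten3 ::
  "('k::field, 'u::ab_group_add, 'm) vspace_scheme \<Rightarrow> ('k, 'v::ab_group_add, 'p) vspace_scheme
    \<Rightarrow> ('k, 'w::ab_group_add, 'q) vspace_scheme
    \<Rightarrow> 'u \<Rightarrow> 'v \<Rightarrow> 'w \<Rightarrow> ('k, 'u, 'v, 'w) tensor3" where
  "ten3 U V W u v w = (\<lambda>f. if trilinear_form U V W f then f u v w else 0)"

definition fscl :: "'k::field \<Rightarrow> ('x \<Rightarrow> 'k) \<Rightarrow> ('x \<Rightarrow> 'k)" where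
  "fscl c t = (\<lambda>x. c * t x)"

definition tensor_span ::
  "('k::field, 'u::ab_group_add, 'm) vspace_scheme \<Rightarrow> ('k, 'v::ab_group_add, 'p) vspace_scheme
    \<Rightarrow> 'u set \<Rightarrow> 'v set \<Rightarrow> ('k, 'u, 'v) tensor2 set" where
  "tensor_span U V A B = module.span fscl {ten2 U V a b | a b. a \<in> A \<and> b \<in> B}"

definition tensor_space ::
  "('k::field, 'u::ab_group_add, 'm) vspace_scheme \<Rightarrow> ('k, 'v::ab_group_add, 'p) vspace_scheme
    \<Rightarrow> ('k, ('k, 'u, 'v) tensor2) vspace" where
  "tensor_space U V = \<lparr>car = tensor_span U V (car U) (car V), scl = fscl\<rparr>"

lemma vector_space_fscl: "vector_space (fscl :: 'k::field \<Rightarrow> ('x \<Rightarrow> 'k) \<Rightarrow> ('x \<Rightarrow> 'k))"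
  by unfold_locales (auto simp: fscl_def fun_eq_iff algebra_simps)

lemma separating_form:
  assumes "is_vspace V" "w \<in> car V" "w \<noteq> 0"
  shows "\<exists>l. linear_map V ground l \<and> l w = 1"
proof -
  interpret vector_space "scl V" using assms(1) by (simp add: is_vspace_def)
  have ind: "independent {w}" using assms(3) by simp
  define B where "B = extend_basis {w}"
  have B: "independent B" "span B = UNIV" "w \<in> B"
    using independent_extend_basis[OF ind] span_extend_basis[OF ind] extend_basis_superset[OF ind]
    by (auto simp: B_def)
  define l where "l = (\<lambda>x. representation B x w)"
  have "linear_map V ground l"
    using B representation_add[OF B(1)] representation_scale[OF B(1)]
    by (auto simp: linear_map_def ground_def l_def)
  moreover have "l w = 1" using representation_basis[OF B(1) B(3)] by (simp add: l_def)
  ultimately show ?thesis by blast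
qed

lemma linear_map_compose:
  "linear_map U V f \<Longrightarrow> linear_map V W g \<Longrightarrow> linear_map U W (\<lambda>x. g (f x))"
  by (simp add: linear_map_def)

lemma tensor_universal:
  fixes U :: "('k::field, 'u::ab_group_add, 'm) vspace_scheme"
    and V :: "('k, 'v::ab_group_add, 'p) vspace_scheme"
    and W :: "('k, 'w::ab_group_add, 'q) vspace_scheme"
  assumes W: "is_vspace W" and g: "bilinear_map U V W g"
  shows "\<exists>L. linear_map (tensor_space U V) W L \<and>
             (\<forall>u\<in>car U. \<forall>v\<in>car V. L (ten2 U V u v) = g u v) \<and>
             (\<forall>L'. linear_map (tensor_space U V) W L' \<longrightarrow>
                   (\<forall>u\<in>car U. \<forall>v\<in>car V. L' (ten2 U V u v) = g u v) \<longrightarrow>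
                   (\<forall>t\<in>car (tensor_space U V). L' t = L t))"
proof -
  interpret T: vector_space "fscl :: 'k \<Rightarrow> ('k, 'u, 'v) tensor2 \<Rightarrow> _" by (rule vector_space_fscl)
  interpret W: vector_space "scl W" using W by (simp add: is_vspace_def)
  have subW: "W.subspace (car W)" using W by (simp add: is_vspace_def)
  let ?P = "{ten2 U V u v | u v. u \<in> car U \<and> v \<in> car V}"
  let ?T = "T.span ?P"
  have carT: "car (tensor_space U V) = ?T" "scl (tensor_space U V) = fscl"
    by (simp_all add: tensor_space_def tensor_span_def)
  define R where "R t w \<longleftrightarrow> w \<in> car W \<and>
    (\<forall>l. linear_map W ground l \<longrightarrow> l w = t (\<lambda>u v. l (g u v)))" for t w
  have uniq: "w = w'" if "R t w" "R t w'" for t w w'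
  proof (rule ccontr)
    assume "w \<noteq> w'"
    hence "w - w' \<noteq> 0" by simp
    moreover have mem: "w - w' \<in> car W" using that W.subspace_diff[OF subW] by (simp add: R_def)
    ultimately obtain l where l: "linear_map W ground l" "l (w - w') = 1"
      using separating_form[OF \<open>is_vspace W\<close>] by blast
    have "l ((w - w') + w') = l (w - w') + l w'"
      using l(1) mem that(2) unfolding linear_map_def R_def by blast
    moreover have "l w = t (\<lambda>u v. l (g u v))" "l w' = t (\<lambda>u v. l (g u v))"
      using l(1) that unfolding R_def by blast+
    ultimately show False using l(2) by simp
  qed
  have bil: "bilinear_map U V ground (\<lambda>u v. l (g u v))" if "linear_map W ground l" for l
    using g that by (auto simp: bilinear_map_def intro: linear_map_compose)
  have R_pure: "R (ten2 U V u v) (g u v)" if "u \<in> car U" "v \<in> car V" for u v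
    using that g bil by (auto simp: R_def ten2_def bilinear_map_def linear_map_def)
  have R_add: "R (s + t) (w + w')" if "R s w" "R t w'" for s t w w'
    using that W.subspace_add[OF subW] by (auto simp: R_def linear_map_def)
  have R_scl: "R (fscl c t) (scl W c w)" if "R t w" for c t w
    using that W.subspace_scale[OF subW]
    by (auto simp: R_def linear_map_def fscl_def ground_def)
  have R_zero: "R 0 0"
    using W.subspace_0[OF subW] unfolding R_def linear_map_def ground_def
    by (metis W.scale_zero_left mult_zero_left select_convs(2) zero_fun_apply)
  have R_ex: "\<exists>w. R t w" if "t \<in> ?T" for t
    using that
  proof (induction rule: T.span_induct_alt)
    case base
    show ?case using R_zero by blast
  next
    case (step c x y)
    then obtain u v where "x = ten2 U V u v" "u \<in> car U" "v \<in> car V" by blast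
    hence "R x (g u v)" using R_pure by blast
    with step show ?case using R_add R_scl by blast
  qed
  define L where "L t = (THE w. R t w)" for t
  have L: "L t = w" if "R t w" for t w using that uniq unfolding L_def by blast
  have RL: "R t (L t)" if "t \<in> ?T" for t using R_ex[OF that] L by blast
  have lin: "linear_map (tensor_space U V) W L"
    unfolding linear_map_def carT
  proof (intro conjI ballI allI)
    fix x assume x: "x \<in> ?T"
    show "L x \<in> car W" using RL[OF x] by (simp add: R_def)
    show "L (fscl c x) = scl W c (L x)" for c by (rule L[OF R_scl[OF RL[OF x]]])
    fix y assume y: "y \<in> ?T"
    show "L (x + y) = L x + L y" by (rule L[OF R_add[OF RL[OF x] RL[OF y]]])
  qed
  have pure: "\<forall>u\<in>car U. \<forall>v\<in>car V. L (ten2 U V u v) = g u v" using R_pure L by blast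
  have "L' t = L t"
    if L': "linear_map (tensor_space U V) W L'"
       "\<forall>u\<in>car U. \<forall>v\<in>car V. L' (ten2 U V u v) = g u v" and "t \<in> ?T" for L' t
  proof -
    have "t \<in> ?T \<and> L' t = L t" using \<open>t \<in> ?T\<close>
    proof (induction rule: T.span_induct_alt)
      case base
      have "0 \<in> ?T" by (rule T.span_zero)
      have "L' (fscl 0 0) = scl W 0 (L' 0)" "L (fscl 0 0) = scl W 0 (L 0)"
        using L'(1) lin \<open>0 \<in> ?T\<close> unfolding linear_map_def carT by blast+
      hence "L' 0 = L 0" by simp
      with \<open>0 \<in> ?T\<close> show ?case by blast
    next
      case (step c x y)
      have x: "x \<in> ?T" "fscl c x \<in> ?T" using step T.span_base T.span_scale by auto
      have "L' x = L x" using step L'(2) pure by auto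
      moreover have "L' (fscl c x + y) = scl W c (L' x) + L' y"
        "L (fscl c x + y) = scl W c (L x) + L y"
        using x step L'(1) lin unfolding linear_map_def carT by simp_all
      ultimately have "L' (fscl c x + y) = L (fscl c x + y)" using step by simp
      moreover have "fscl c x + y \<in> ?T" using x step T.span_add by blast
      ultimately show ?case by blast
    qed
    thus ?thesis ..
  qed
  thus ?thesis using lin pure unfolding carT by blast
qed

text \<open>
  Sweedler notation: for a tensor \<open>t\<close>, written as a sum of terms \<open>u \<otimes> v\<close>, and a bilinear map \<open>g\<close> into
  a (twofold or threefold) tensor product, \<open>sweedler t g\<close> is the sum of the terms \<open>g u v\<close>.
\<close>

definition sweedler ::
  "('k, 'u, 'v) tensor2 \<Rightarrow> ('u \<Rightarrow> 'v \<Rightarrow> ('f \<Rightarrow> 'k)) \<Rightarrow> ('f \<Rightarrow> 'k)" where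
  "sweedler t g = (\<lambda>f. t (\<lambda>u v. g u v f))"


section \<open>Hopf coquasigroups\<close>

record ('k, 'v) coquasi = "('k, 'v) vspace" +
  mul :: "'v \<Rightarrow> 'v \<Rightarrow> 'v"
  unt :: "'v"
  cop :: "'v \<Rightarrow> ('k, 'v, 'v) tensor2"
  cou :: "'v \<Rightarrow> 'k"
  ant :: "'v \<Rightarrow> 'v"

definition unital_assoc_algebra :: "('k::field, 'v::ab_group_add, 'm) coquasi_scheme \<Rightarrow> bool" where
  "unital_assoc_algebra H \<longleftrightarrow>
     is_vspace H \<and> bilinear_map H H H (mul H) \<and> unt H \<in> car H \<and>
     (\<forall>x\<in>car H. mul H (unt H) x = x \<and> mul H x (unt H) = x) \<and>
     (\<forall>x\<in>car H. \<forall>y\<in>car H. \<forall>z\<in>car H. mul H (mul H x y) z = mul H x (mul H y z))"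

text \<open>
  For a trilinear map \<open>g\<close>, \<open>cop_left H h g\<close> is the image under \<open>g\<close> of \<open>(\<Delta> \<otimes> id) \<Delta> h\<close>, and
  \<open>cop_right H h g\<close> the image of \<open>(id \<otimes> \<Delta>) \<Delta> h\<close>.
\<close>

definition cop_left ::
  "('k::field, 'v::ab_group_add, 'm) coquasi_scheme \<Rightarrow> 'v
    \<Rightarrow> ('v \<Rightarrow> 'v \<Rightarrow> 'v \<Rightarrow> ('f \<Rightarrow> 'k)) \<Rightarrow> ('f \<Rightarrow> 'k)" where
  "cop_left H h g =
     sweedler (cop H h) (\<lambda>h1 h2. sweedler (cop H h1) (\<lambda>h11 h12. g h11 h12 h2))"

definition cop_right ::
  "('k::field, 'v::ab_group_add, 'm) coquasi_scheme \<Rightarrow> 'v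
    \<Rightarrow> ('v \<Rightarrow> 'v \<Rightarrow> 'v \<Rightarrow> ('f \<Rightarrow> 'k)) \<Rightarrow> ('f \<Rightarrow> 'k)" where
  "cop_right H h g =
     sweedler (cop H h) (\<lambda>h1 h2. sweedler (cop H h2) (\<lambda>h21 h22. g h1 h21 h22))"

definition counit_alg_hom :: "('k::field, 'v::ab_group_add, 'm) coquasi_scheme \<Rightarrow> bool" where
  "counit_alg_hom H \<longleftrightarrow>
     linear_map H ground (cou H) \<and> cou H (unt H) = 1 \<and>
     (\<forall>g\<in>car H. \<forall>h\<in>car H. cou H (mul H g h) = cou H g * cou H h)"

definition coproduct_alg_hom :: "('k::field, 'v::ab_group_add, 'm) coquasi_scheme \<Rightarrow> bool" where
  "coproduct_alg_hom H \<longleftrightarrow>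
     linear_map H (tensor_space H H) (cop H) \<and>
     cop H (unt H) = ten2 H H (unt H) (unt H) \<and>
     (\<forall>g\<in>car H. \<forall>h\<in>car H.
        cop H (mul H g h) =
          sweedler (cop H g) (\<lambda>g1 g2. sweedler (cop H h) (\<lambda>h1 h2.
            ten2 H H (mul H g1 h1) (mul H g2 h2))))"

text \<open>The counit laws are stated in \<open>k \<otimes> H\<close> and \<open>H \<otimes> k\<close>, without identifying these with \<open>H\<close>.\<close>

definition counital :: "('k::field, 'v::ab_group_add, 'm) coquasi_scheme \<Rightarrow> bool" where
  "counital H \<longleftrightarrow>
     (\<forall>h\<in>car H.
        sweedler (cop H h) (\<lambda>h1 h2. ten2 ground H (cou H h1) h2) = ten2 ground H 1 h \<and>
        sweedler (cop H h) (\<lambda>h1 h2. ten2 H ground h1 (cou H h2)) = ten2 H ground h 1)"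

definition hopf_coquasigroup :: "('k::field, 'v::ab_group_add, 'm) coquasi_scheme \<Rightarrow> bool" where
  "hopf_coquasigroup H \<longleftrightarrow>
     unital_assoc_algebra H \<and> coproduct_alg_hom H \<and> counit_alg_hom H \<and> counital H \<and>
     linear_map H H (ant H) \<and>
     (\<forall>h\<in>car H.
        cop_right H h (\<lambda>h1 h21 h22. ten2 H H (mul H (ant H h1) h21) h22) = ten2 H H (unt H) h \<and>
        cop_right H h (\<lambda>h1 h21 h22. ten2 H H (mul H h1 (ant H h21)) h22) = ten2 H H (unt H) h \<and>
        cop_left H h (\<lambda>h11 h12 h2. ten2 H H h11 (mul H (ant H h12) h2)) = ten2 H H h (unt H) \<and>
        cop_left H h (\<lambda>h11 h12 h2. ten2 H H h11 (mul H h12 (ant H h2))) = ten2 H H h (unt H))"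

definition hopf_algebra :: "('k::field, 'v::ab_group_add, 'm) coquasi_scheme \<Rightarrow> bool" where
  "hopf_algebra H \<longleftrightarrow>
     hopf_coquasigroup H \<and>
     (\<forall>h\<in>car H. cop_left H h (ten3 H H H) = cop_right H h (ten3 H H H))"

definition coquasi_morphism ::
  "('k::field, 'v::ab_group_add, 'm) coquasi_scheme \<Rightarrow> ('k, 'w::ab_group_add, 'p) coquasi_scheme
    \<Rightarrow> ('v \<Rightarrow> 'w) \<Rightarrow> bool" where
  "coquasi_morphism B C \<phi> \<longleftrightarrow>
     linear_map B C \<phi> \<and> \<phi> (unt B) = unt C \<and>
     (\<forall>x\<in>car B. \<forall>y\<in>car B. \<phi> (mul B x y) = mul C (\<phi> x) (\<phi> y)) \<and>
     (\<forall>b\<in>car B. sweedler (cop B b) (\<lambda>b1 b2. ten2 C C (\<phi> b1) (\<phi> b2)) = cop C (\<phi> b)) \<and>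
     (\<forall>b\<in>car B. cou C (\<phi> b) = cou B b)"

definition coassociator ::
  "('k::field, 'v::ab_group_add, 'm) coquasi_scheme \<Rightarrow> 'v \<Rightarrow> ('k, 'v, 'v, 'v) tensor3" where
  "coassociator B b =
     sweedler (cop B b) (\<lambda>b1 b2.
       cop_right B b1 (\<lambda>b11 b121 b122.
         cop_left B (ant B b2) (\<lambda>s11 s12 s2.
           ten3 B B B (mul B b11 s11) (mul B b121 s12) (mul B b122 s2))))"

definition coassociative_pair ::
  "('k::field, 'w::ab_group_add, 'p) coquasi_scheme \<Rightarrow> ('k, 'v::ab_group_add, 'm) coquasi_scheme
    \<Rightarrow> ('v \<Rightarrow> 'w) \<Rightarrow> bool" where
  "coassociative_pair C B \<phi> \<longleftrightarrow>
     hopf_coquasigroup B \<and> hopf_algebra C \<and> coquasi_morphism B C \<phi> \<and>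
     (\<forall>b\<in>car B.
        cop_left B b (\<lambda>x y z. ten3 C B B (\<phi> x) y z) =
          cop_right B b (\<lambda>x y z. ten3 C B B (\<phi> x) y z) \<and>
        cop_left B b (\<lambda>x y z. ten3 B C B x (\<phi> y) z) =
          cop_right B b (\<lambda>x y z. ten3 B C B x (\<phi> y) z) \<and>
        cop_left B b (\<lambda>x y z. ten3 B B C x y (\<phi> z)) =
          cop_right B b (\<lambda>x y z. ten3 B B C x y (\<phi> z)))"

definition ker_on :: "('k, 'v, 'm) vspace_scheme \<Rightarrow> ('v \<Rightarrow> 'w::zero) \<Rightarrow> 'v set" where
  "ker_on V f = {x \<in> car V. f x = 0}"

definition quasi_coassociative ::
  "('k::field, 'w::ab_group_add, 'p) coquasi_scheme \<Rightarrow> ('k, 'v::ab_group_add, 'm) coquasi_scheme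
    \<Rightarrow> ('v \<Rightarrow> 'w) \<Rightarrow> bool" where
  "quasi_coassociative C B \<phi> \<longleftrightarrow>
     coassociative_pair C B \<phi> \<and>
     \<phi> ` car B = car C \<and>
     (\<forall>i\<in>ker_on B \<phi>.
        cop_left B i (\<lambda>i11 i12 i2. ten2 B B (mul B i11 (ant B i2)) i12)
          \<in> tensor_span B B (car B) (ker_on B \<phi>) \<and>
        cop_right B i (\<lambda>i1 i21 i22. ten2 B B (mul B i1 (ant B i22)) i21)
          \<in> tensor_span B B (car B) (ker_on B \<phi>)) \<and>
     ker_on B \<phi> \<subseteq> ker_on B (coassociator B)"


section \<open>The Cayley algebra and its basis quasigroup\<close>

text \<open>
  The group \<open>Z2^n\<close>, as bit vectors vanishing from position \<open>n\<close> on, with pointwise addition.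
\<close>

type_synonym bvec = "nat \<Rightarrow> bit"

definition Z2n :: "nat \<Rightarrow> bvec set" where
  "Z2n n = {a. \<forall>m\<ge>n. a m = 0}"

definition unital_cochain :: "nat \<Rightarrow> (bvec \<Rightarrow> bvec \<Rightarrow> 'k::field) \<Rightarrow> bool" where
  "unital_cochain n F \<longleftrightarrow>
     (\<forall>a\<in>Z2n n. \<forall>b\<in>Z2n n. F a b \<noteq> 0) \<and> (\<forall>a\<in>Z2n n. F a 0 = 1 \<and> F 0 a = 1)"

text \<open>Elements of the Cayley algebra are coefficient functions with respect to the basis.\<close>

definition cayley_mult ::
  "nat \<Rightarrow> (bvec \<Rightarrow> bvec \<Rightarrow> 'k::field) \<Rightarrow> (bvec \<Rightarrow> 'k) \<Rightarrow> (bvec \<Rightarrow> 'k) \<Rightarrow> (bvec \<Rightarrow> 'k)" where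
  "cayley_mult n F x y =
     (\<lambda>c. \<Sum>(a, b) | a \<in> Z2n n \<and> b \<in> Z2n n \<and> a + b = c. x a * y b * F a b)"

definition cayley_basis :: "bvec \<Rightarrow> (bvec \<Rightarrow> 'k::field)" where
  "cayley_basis a = (\<lambda>c. if c = a then 1 else 0)"

definition sgn_basis :: "bvec \<Rightarrow> bit \<Rightarrow> (bvec \<Rightarrow> 'k::field)" where
  "sgn_basis a i = (if i = 0 then cayley_basis a else - cayley_basis a)"

definition basis_loop :: "nat \<Rightarrow> (bvec \<Rightarrow> 'k::field) set" where
  "basis_loop n = {sgn_basis a i | a i. a \<in> Z2n n}"

definition quasigroup :: "'g set \<Rightarrow> ('g \<Rightarrow> 'g \<Rightarrow> 'g) \<Rightarrow> 'g \<Rightarrow> bool" where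
  "quasigroup G m e \<longleftrightarrow>
     (\<forall>g\<in>G. \<forall>h\<in>G. m g h \<in> G) \<and>
     e \<in> G \<and> (\<forall>g\<in>G. m e g = g \<and> m g e = g) \<and>
     (\<forall>g\<in>G. \<exists>g'\<in>G. \<forall>h\<in>G. m g' (m g h) = h \<and> m (m h g') g = h)"


section \<open>The algebra of functions on the basis quasigroup\<close>

type_synonym 'k gfun = "(bvec \<Rightarrow> 'k) \<Rightarrow> 'k"

text \<open>Functions on a subset are represented by their extension by \<open>0\<close>.\<close>

definition fun_space :: "nat \<Rightarrow> ('k::field, 'k gfun) vspace" where
  "fun_space n = \<lparr>car = {f. \<forall>g. g \<notin> basis_loop n \<longrightarrow> f g = 0}, scl = fscl\<rparr>"

definition delta_fun :: "bvec \<Rightarrow> bit \<Rightarrow> 'k::field gfun" where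
  "delta_fun a i = (\<lambda>g. if g = sgn_basis a i then 1 else 0)"

text \<open>
  In the formulas \<open>\<Delta> f_a^i = \<Sum> F(b,c) f_b^j \<otimes> f_c^k\<close> and \<open>S f_a^i = F(a,a) f_a^i\<close> the values of \<open>F\<close> are
  signs (as \<open>G_n\<close> is closed under the product), and a sign acts on a delta function through the
  point at which it is supported: \<open>-f_a^i\<close> is the delta function at \<open>-e_a^i\<close>, that is, \<open>f_a^(i+1)\<close>.
  Read instead as scalar factors in \<open>k\<close>, they would not make \<open>\<Delta>\<close> multiplicative. For this reading
  \<open>\<Delta>\<close> is dual to the product of \<open>G_n\<close>; see \<open>cop_dual_product\<close> below.
\<close>

definition sgn_act :: "'k::field \<Rightarrow> 'k gfun \<Rightarrow> 'k gfun" where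
  "sgn_act s f = (\<lambda>g. f (fscl (inverse s) g))"

definition delta_cop ::
  "nat \<Rightarrow> (bvec \<Rightarrow> bvec \<Rightarrow> 'k::field) \<Rightarrow> bvec \<Rightarrow> bit \<Rightarrow> ('k, 'k gfun, 'k gfun) tensor2" where
  "delta_cop n F a i =
     (\<Sum>(b, c) | b \<in> Z2n n \<and> c \<in> Z2n n \<and> b + c = a. \<Sum>(j, k) | j + k = i.
        ten2 (fun_space n) (fun_space n) (sgn_act (F b c) (delta_fun b j)) (delta_fun c k))"

text \<open>The structure maps are the linear extensions of their values on the delta functions.\<close>

definition lin_ext :: "nat \<Rightarrow> (bvec \<Rightarrow> bit \<Rightarrow> ('x \<Rightarrow> 'k::field)) \<Rightarrow> 'k gfun \<Rightarrow> ('x \<Rightarrow> 'k)" where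
  "lin_ext n v h = (\<Sum>a\<in>Z2n n. \<Sum>i\<in>UNIV. fscl (h (sgn_basis a i)) (v a i))"

definition fun_coquasi ::
  "nat \<Rightarrow> (bvec \<Rightarrow> bvec \<Rightarrow> 'k::field) \<Rightarrow> ('k, 'k gfun) coquasi" where
  "fun_coquasi n F =
     \<lparr>car = car (fun_space n), scl = scl (fun_space n),
      mul = (\<lambda>f g. f * g),
      unt = (\<Sum>a\<in>Z2n n. \<Sum>i\<in>UNIV. delta_fun a i),
      cop = lin_ext n (delta_cop n F),
      cou = (\<lambda>h. \<Sum>a\<in>Z2n n. \<Sum>i\<in>UNIV. h (sgn_basis a i) * (if a = 0 \<and> i = 0 then 1 else 0)),
      ant = lin_ext n (\<lambda>a i. sgn_act (F a a) (delta_fun a i))\<rparr>"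

definition restrict_proj :: "'k::field gfun \<Rightarrow> 'k gfun" where
  "restrict_proj f = (\<lambda>g. if g \<in> basis_loop 0 then f g else 0)"


section \<open>Compatibility with the product of the quasigroup\<close>

lemma finite_Z2n: "finite (Z2n n)"
proof (rule finite_subset)
  show "Z2n n \<subseteq> (\<lambda>S m. if m \<in> S then 1 else 0) ` Pow {..<n}"
  proof
    fix a assume a: "a \<in> Z2n n"
    have "a = (\<lambda>m. if m \<in> {m. a m = 1} then 1 else 0)"
      by (auto simp: fun_eq_iff)
    moreover have "{m. a m = 1} \<subseteq> {..<n}"
      using a by (auto simp: Z2n_def) (metis linorder_not_less zero_neq_one)
    ultimately show "a \<in> (\<lambda>S m. if m \<in> S then 1 else 0) ` Pow {..<n}" by blast
  qed
qed simp

lemma Z2n_add: "a \<in> Z2n n \<Longrightarrow> b \<in> Z2n n \<Longrightarrow> a + b \<in> Z2n n"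
  by (simp add: Z2n_def)

lemma sgn_basis_mult:
  assumes "a \<in> Z2n n" "b \<in> Z2n n"
  shows "cayley_mult n F (sgn_basis a i) (sgn_basis b j) = fscl (F a b) (sgn_basis (a + b) (i + j))"
proof
  fix c
  let ?s = "\<lambda>i::bit. if i = 0 then (1::'a) else -1"
  have s: "sgn_basis a i c = (if c = a then ?s i else 0)" for a i c
    by (simp add: sgn_basis_def cayley_basis_def)
  have fin: "finite {(x, y). x \<in> Z2n n \<and> y \<in> Z2n n \<and> x + y = c}"
    by (rule finite_subset[OF _ finite_cartesian_product[OF finite_Z2n finite_Z2n]]) auto
  have "cayley_mult n F (sgn_basis a i) (sgn_basis b j) c =
    (\<Sum>p\<in>{(x, y). x \<in> Z2n n \<and> y \<in> Z2n n \<and> x + y = c}. if p = (a, b) then ?s i * ?s j * F a b else 0)"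
    unfolding cayley_mult_def by (rule sum.cong) (auto simp: s split: if_splits)
  also have "\<dots> = (if a + b = c then ?s i * ?s j * F a b else 0)"
    using fin assms by (simp add: sum.delta)
  also have "\<dots> = fscl (F a b) (sgn_basis (a + b) (i + j)) c"
    by (auto simp: fscl_def s)
  finally show "cayley_mult n F (sgn_basis a i) (sgn_basis b j) c = \<dots>" .
qed

lemma sgn_basis_inj:
  assumes "(1::'k::field) \<noteq> - 1"
  shows "(sgn_basis a i :: bvec \<Rightarrow> 'k) = sgn_basis b j \<longleftrightarrow> a = b \<and> i = j"
proof
  assume eq: "(sgn_basis a i :: bvec \<Rightarrow> 'k) = sgn_basis b j"
  from fun_cong[OF eq, of a] have "a = b"
    by (auto simp: sgn_basis_def cayley_basis_def split: if_splits)
  moreover from fun_cong[OF eq, of a] have "i = j"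
    using assms assms[symmetric] \<open>a = b\<close>
    by (cases "i = 0"; cases "j = 0") (auto simp: sgn_basis_def cayley_basis_def)
  ultimately show "a = b \<and> i = j" ..
qed simp

lemma delta_fun_apply:
  assumes "(1::'k::field) \<noteq> - 1"
  shows "delta_fun a i (sgn_basis b j :: bvec \<Rightarrow> 'k) = (if a = b \<and> i = j then 1 else 0)"
  using sgn_basis_inj[OF assms] by (auto simp: delta_fun_def)

lemma cochain_sign:
  fixes F :: "bvec \<Rightarrow> bvec \<Rightarrow> 'k::field"
  assumes Q: "quasigroup (basis_loop n) (cayley_mult n F) (sgn_basis 0 0)"
    and ab: "a \<in> Z2n n" "b \<in> Z2n n"
  shows "F a b = 1 \<or> F a b = - 1"
proof -
  have "sgn_basis a 0 \<in> basis_loop n" "sgn_basis b 0 \<in> basis_loop n"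
    using ab by (auto simp: basis_loop_def)
  hence "cayley_mult n F (sgn_basis a 0) (sgn_basis b 0) \<in> basis_loop n"
    using Q unfolding quasigroup_def by blast
  then obtain c i where "fscl (F a b) (sgn_basis (a + b) 0) = (sgn_basis c i :: bvec \<Rightarrow> 'k)"
    using sgn_basis_mult[OF ab, of F 0 0] by (auto simp: basis_loop_def)
  from fun_cong[OF this, of c] show ?thesis
    by (auto simp: fscl_def sgn_basis_def cayley_basis_def split: if_splits)
qed

lemma cop_dual_product:
  fixes F :: "bvec \<Rightarrow> bvec \<Rightarrow> 'k::field"
  assumes two: "(1::'k) \<noteq> - 1"
    and Q: "quasigroup (basis_loop n) (cayley_mult n F) (sgn_basis 0 0)"
  shows "cop (fun_coquasi n F) h =
    (\<Sum>x\<in>basis_loop n. \<Sum>y\<in>basis_loop n. fscl (h (cayley_mult n F x y))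
       (ten2 (fun_space n) (fun_space n) (\<lambda>g. if g = x then 1 else 0) (\<lambda>g. if g = y then 1 else 0)))"
proof -
  let ?Z = "Z2n n"
  let ?D = "\<lambda>x g. if g = x then 1 else (0::'k)"
  let ?t = "\<lambda>x y. ten2 (fun_space n) (fun_space n) (?D x) (?D y)"
  let ?e = "sgn_basis :: bvec \<Rightarrow> bit \<Rightarrow> bvec \<Rightarrow> 'k"
  have UB: "(UNIV :: bit set) = {0, 1}" by (rule set_eqI, rename_tac x, case_tac "x = 0") auto
  have finB: "finite (UNIV :: bit set)" by (simp add: UB)
  have sumB: "(\<Sum>j\<in>UNIV. \<psi> j) = \<psi> 0 + \<psi> 1" for \<psi> :: "bit \<Rightarrow> 'z::comm_monoid_add"
    by (simp add: UB)
  have inj: "inj_on (\<lambda>(a, i). ?e a i) (?Z \<times> UNIV)"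
    using sgn_basis_inj[OF two] by (auto simp: inj_on_def)
  have loop: "basis_loop n = (\<lambda>(a, i). ?e a i) ` (?Z \<times> UNIV)"
    by (auto simp: basis_loop_def)
  have sumL: "(\<Sum>x\<in>basis_loop n. \<psi> x) = (\<Sum>a\<in>?Z. \<Sum>i\<in>UNIV. \<psi> (?e a i))"
    for \<psi> :: "_ \<Rightarrow> 'z::comm_monoid_add"
    unfolding loop sum.reindex[OF inj] by (simp add: sum.cartesian_product case_prod_beta)
  have fscl_sum: "fscl c (sum \<psi> A) = (\<Sum>x\<in>A. fscl c (\<psi> x))"
    for c and \<psi> :: "'z \<Rightarrow> 'y \<Rightarrow> 'k" and A
  proof -
    interpret vector_space "fscl :: 'k \<Rightarrow> ('y \<Rightarrow> 'k) \<Rightarrow> _" by (rule vector_space_fscl)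
    show ?thesis by (rule scale_sum_right)
  qed
  have act: "sgn_act (F b c) (delta_fun b j) = ?D (fscl (F b c) (?e b j))"
    if "b \<in> ?Z" "c \<in> ?Z" for b c j
  proof -
    have "F b c = 1 \<or> F b c = -1" using cochain_sign[OF Q that] .
    hence "fscl (inverse (F b c)) g = ?e b j \<longleftrightarrow> g = fscl (F b c) (?e b j)" for g
      by (auto simp: fscl_def fun_eq_iff) (metis minus_minus)
    thus ?thesis by (simp add: sgn_act_def delta_fun_def)
  qed
  have bc: "(\<Sum>j\<in>UNIV. \<Sum>k\<in>UNIV. fscl (h (?e (b + c) (j + k))) (?t (fscl (F b c) (?e b j)) (?e c k)))
      = (\<Sum>j\<in>UNIV. \<Sum>k\<in>UNIV. fscl (h (cayley_mult n F (?e b j) (?e c k))) (?t (?e b j) (?e c k)))"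
    if "b \<in> ?Z" "c \<in> ?Z" for b c
  proof -
    have neg: "fscl (-1) (?e a 0) = ?e a 1" "fscl (-1) (?e a 1) = ?e a 0"
      "fscl 1 (?e a i) = ?e a i" for a i
      by (simp_all add: fscl_def sgn_basis_def fun_eq_iff)
    show ?thesis
      using cochain_sign[OF Q that]
      by (auto simp: sgn_basis_mult[OF that] sumB neg add_ac)
  qed
  have inner: "(\<Sum>i\<in>UNIV. \<Sum>(j, k) | j + k = i. fscl (h (?e a i)) (\<psi> j k))
      = (\<Sum>j\<in>UNIV. \<Sum>k\<in>UNIV. fscl (h (?e a (j + k))) (\<psi> j k))"
    for a and \<psi> :: "bit \<Rightarrow> bit \<Rightarrow> 'y \<Rightarrow> 'k"
  proof -
    have "{(j, k). j + k = (0::bit)} = {(0, 0), (1, 1)}"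
         "{(j, k). j + k = (1::bit)} = {(0, 1), (1, 0)}"
      by (rule set_eqI, rename_tac p, case_tac p, rename_tac j k, case_tac "j = 0"; case_tac "k = 0"; auto)+
    thus ?thesis by (simp add: sumB add_ac)
  qed
  have fibres: "(\<Sum>a\<in>?Z. \<Sum>(b, c) | b \<in> ?Z \<and> c \<in> ?Z \<and> b + c = a. \<psi> a b c)
      = (\<Sum>b\<in>?Z. \<Sum>c\<in>?Z. \<psi> (b + c) b c)" for \<psi> :: "_ \<Rightarrow> _ \<Rightarrow> _ \<Rightarrow> 'z::comm_monoid_add"
  proof -
    have "(\<Sum>b\<in>?Z. \<Sum>c\<in>?Z. \<psi> (b + c) b c) = (\<Sum>p\<in>?Z\<times>?Z. \<psi> (fst p + snd p) (fst p) (snd p))"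
      by (simp add: sum.cartesian_product case_prod_beta)
    also have "\<dots> = (\<Sum>a\<in>?Z. \<Sum>p | p \<in> ?Z\<times>?Z \<and> fst p + snd p = a.
        \<psi> (fst p + snd p) (fst p) (snd p))"
      by (rule sum.group[symmetric]) (auto simp: finite_Z2n Z2n_add)
    also have "\<dots> = (\<Sum>a\<in>?Z. \<Sum>(b, c) | b \<in> ?Z \<and> c \<in> ?Z \<and> b + c = a. \<psi> a b c)"
      by (intro sum.cong refl) auto
    finally show ?thesis ..
  qed
  have "cop (fun_coquasi n F) h = (\<Sum>a\<in>?Z. \<Sum>i\<in>UNIV. \<Sum>(b, c) | b \<in> ?Z \<and> c \<in> ?Z \<and> b + c = a.
      \<Sum>(j, k) | j + k = i. fscl (h (?e a i)) (?t (fscl (F b c) (?e b j)) (?e c k)))"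
    unfolding fun_coquasi_def lin_ext_def delta_cop_def coquasi.simps
    by (intro sum.cong refl)
       (auto simp: fscl_sum act[unfolded delta_fun_def] case_prod_beta delta_fun_def intro!: sum.cong)
  also have "\<dots> = (\<Sum>a\<in>?Z. \<Sum>(b, c) | b \<in> ?Z \<and> c \<in> ?Z \<and> b + c = a. \<Sum>j\<in>UNIV. \<Sum>k\<in>UNIV.
      fscl (h (?e a (j + k))) (?t (fscl (F b c) (?e b j)) (?e c k)))"
    by (subst sum.swap) (intro sum.cong refl, rename_tac a p, case_tac p, simp only: prod.case, rule inner)
  also have "\<dots> = (\<Sum>b\<in>?Z. \<Sum>c\<in>?Z. \<Sum>j\<in>UNIV. \<Sum>k\<in>UNIV.
      fscl (h (?e (b + c) (j + k))) (?t (fscl (F b c) (?e b j)) (?e c k)))"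
    by (rule fibres)
  also have "\<dots> = (\<Sum>b\<in>?Z. \<Sum>c\<in>?Z. \<Sum>j\<in>UNIV. \<Sum>k\<in>UNIV.
      fscl (h (cayley_mult n F (?e b j) (?e c k))) (?t (?e b j) (?e c k)))"
    by (intro sum.cong refl bc)
  also have "\<dots> = (\<Sum>b\<in>?Z. \<Sum>j\<in>UNIV. \<Sum>c\<in>?Z. \<Sum>k\<in>UNIV.
      fscl (h (cayley_mult n F (?e b j) (?e c k))) (?t (?e b j) (?e c k)))"
    by (intro sum.cong refl sum.swap)
  finally show ?thesis by (simp only: sumL)
qed

end

(*
  Evaluating the two legs of the coproduct of a function h on a finite loop G at points x and y
  gives h(xy), so every expression in Sweedler notation becomes the function obtained from h by
  substituting a word of the loop. The Hopf coquasigroup axioms are then the inverse property of G.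
  For a subloop Z that is nuclear, normal and contains all elements (x(yz))((xy)z)^(-1), restriction
  to Z is quasi coassociative: nuclearity gives the coassociative pair, normality condition (2), and
  the coassociator sends h to (x, y, z) |-> h((x(yz))((xy)z)^(-1)), which gives condition (3).
  The signs Z = {e_0, -e_0} form such a subloop of the Cayley basis, since the index a of e_a is
  additive with values in an elementary abelian 2-group.
*)

theory Submission
  imports Defs
begin

section \<open>Tensor products of spaces of functions on finite sets\<close>

definition supported :: "'g set \<Rightarrow> ('k::field, 'g \<Rightarrow> 'k) vspace" where
  "supported G = \<lparr>car = {f. \<forall>g. g \<notin> G \<longrightarrow> f g = 0}, scl = fscl\<rparr>"

text \<open>A predicate on record schemes, so that the expansions below apply directly to the
  algebras \<open>H\<close> and \<open>C\<close>, whose records carry further fields.\<close>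

definition is_supported :: "('k::field, 'g \<Rightarrow> 'k, 'm) vspace_scheme \<Rightarrow> 'g set \<Rightarrow> bool" where
  "is_supported V G \<longleftrightarrow> car V = {f. \<forall>g. g \<notin> G \<longrightarrow> f g = 0} \<and> scl V = fscl"

definition delta :: "'g \<Rightarrow> 'g \<Rightarrow> 'k::field" where
  "delta x = (\<lambda>g. if g = x then 1 else 0)"

lemma sum_fun_apply: "sum f A x = (\<Sum>a\<in>A. f a x)"
  by (induction A rule: infinite_finite_induct) (auto simp: zero_fun_def)

lemma fscl_apply [simp]: "fscl c t x = c * t x"
  by (simp add: fscl_def)

lemma fscl_fscl: "fscl a (fscl b t) = fscl (a * b) t"
  by (auto simp: fun_eq_iff)

lemma car_supported: "is_supported V G \<Longrightarrow> u \<in> car V \<longleftrightarrow> (\<forall>g. g \<notin> G \<longrightarrow> u g = 0)"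
  by (simp add: is_supported_def)

lemma scl_supported: "is_supported V G \<Longrightarrow> scl V = fscl"
  by (simp add: is_supported_def)

lemma delta_car: "is_supported V G \<Longrightarrow> x \<in> G \<Longrightarrow> delta x \<in> car V"
  by (auto simp: car_supported delta_def)

lemma is_vspace_supported:
  fixes V :: "('k::field, 'g \<Rightarrow> 'k, 'm) vspace_scheme"
  assumes "is_supported V G"
  shows "is_vspace V"
proof -
  interpret vector_space "fscl :: 'k \<Rightarrow> ('g \<Rightarrow> 'k) \<Rightarrow> _" by (rule vector_space_fscl)
  have "subspace (car V)"
    using assms by (auto simp: is_supported_def subspace_def)
  thus ?thesis
    using assms vector_space_fscl by (auto simp: is_supported_def is_vspace_def)
qed

section \<open>Coordinates with respect to the delta functions\<close>

lemma linear_map_zero: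
  fixes V :: "('k::field, 'g \<Rightarrow> 'k, 'm) vspace_scheme"
  assumes "is_supported V G" "linear_map V ground l"
  shows "l 0 = 0"
proof -
  have "l (fscl 0 0) = 0 * l 0"
    using assms by (auto simp: is_supported_def linear_map_def ground_def)
  moreover have "fscl 0 0 = (0 :: 'g \<Rightarrow> 'k)" by (auto simp: fun_eq_iff)
  ultimately show ?thesis by simp
qed

lemma linear_map_expand:
  assumes V: "is_supported V G" and fin: "finite G"
    and l: "linear_map V ground l" and u: "u \<in> car V"
  shows "l u = (\<Sum>x\<in>G. u x * l (delta x))"
proof -
  \<comment> \<open>A linear map is additive only on the carrier, so the induction over subsets of
    \<open>G\<close> also carries along that the partial sums lie in it.\<close>
  have part: "(\<Sum>x\<in>A. fscl (u x) (delta x)) \<in> car V \<and>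
      l (\<Sum>x\<in>A. fscl (u x) (delta x)) = (\<Sum>x\<in>A. u x * l (delta x))" if "A \<subseteq> G" for A
    using finite_subset[OF that fin] that
  proof (induction A rule: finite_induct)
    case empty
    show ?case using linear_map_zero[OF V l] V
      by (simp only: sum.empty) (simp add: car_supported)
  next
    case (insert x A)
    have d: "delta x \<in> car V" "fscl (u x) (delta x) \<in> car V"
      using insert V by (auto simp: car_supported delta_def)
    have "l (fscl (u x) (delta x)) = u x * l (delta x)"
      using l d V by (simp add: linear_map_def ground_def scl_supported)
    moreover have "fscl (u x) (delta x) + (\<Sum>x\<in>A. fscl (u x) (delta x)) \<in> car V"
      using insert V d by (simp add: car_supported sum_fun_apply)
    moreover have "l (fscl (u x) (delta x) + (\<Sum>x\<in>A. fscl (u x) (delta x)))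
        = l (fscl (u x) (delta x)) + l (\<Sum>x\<in>A. fscl (u x) (delta x))"
      using insert d l unfolding linear_map_def by blast
    ultimately show ?case
      using insert by (simp only: sum.insert insert_subset simp_thms)
  qed
  have "u = (\<Sum>x\<in>G. fscl (u x) (delta x))"
  proof
    fix g
    have "(\<Sum>x\<in>G. fscl (u x) (delta x)) g = (\<Sum>x\<in>G. if g = x then u x else 0)"
      by (auto simp: sum_fun_apply delta_def intro!: sum.cong)
    also have "\<dots> = u g" using u V fin by (simp add: car_supported)
    finally show "u g = (\<Sum>x\<in>G. fscl (u x) (delta x)) g" ..
  qed
  thus ?thesis using part[OF subset_refl] by simp
qed

text \<open>Tensors are functionals, so both sides are compared form by form: a bilinear form
  expands in one argument after the other, and on all other functions every tensor vanishes.\<close>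

lemma ten2_expand:
  assumes U: "is_supported U A" "finite A" and V: "is_supported V B" "finite B"
    and u: "u \<in> car U" and v: "v \<in> car V"
  shows "ten2 U V u v = (\<Sum>(x, y)\<in>A \<times> B. fscl (u x * v y) (ten2 U V (delta x) (delta y)))"
proof
  fix f
  show "ten2 U V u v f = (\<Sum>(x, y)\<in>A \<times> B. fscl (u x * v y) (ten2 U V (delta x) (delta y))) f"
  proof (cases "bilinear_map U V ground f")
    case True
    have "f u v = (\<Sum>x\<in>A. u x * f (delta x) v)"
      using True v by (intro linear_map_expand[OF U _ u]) (auto simp: bilinear_map_def)
    also have "\<dots> = (\<Sum>x\<in>A. u x * (\<Sum>y\<in>B. v y * f (delta x) (delta y)))"
      using True by (intro sum.cong refl arg_cong2[where f = "(*)"] linear_map_expand[OF V _ v])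
        (auto simp: bilinear_map_def delta_car[OF U(1)])
    also have "\<dots> = (\<Sum>(x, y)\<in>A \<times> B. u x * v y * f (delta x) (delta y))"
      by (simp add: sum_distrib_left sum.cartesian_product mult.assoc)
    finally show ?thesis using True
      by (simp add: ten2_def sum_fun_apply case_prod_beta)
  qed (simp add: ten2_def sum_fun_apply case_prod_beta)
qed

lemma ten3_expand:
  assumes U: "is_supported U A" "finite A" and V: "is_supported V B" "finite B"
    and W: "is_supported W C" "finite C"
    and u: "u \<in> car U" and v: "v \<in> car V" and w: "w \<in> car W"
  shows "ten3 U V W u v w =
    (\<Sum>(x, y, z)\<in>A \<times> B \<times> C. fscl (u x * v y * w z) (ten3 U V W (delta x) (delta y) (delta z)))"
proof
  fix f
  show "ten3 U V W u v w f =
    (\<Sum>(x, y, z)\<in>A \<times> B \<times> C. fscl (u x * v y * w z) (ten3 U V W (delta x) (delta y) (delta z))) f"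
  proof (cases "trilinear_form U V W f")
    case True
    have "f u v w = (\<Sum>x\<in>A. u x * f (delta x) v w)"
      using True v w by (intro linear_map_expand[OF U _ u]) (auto simp: trilinear_form_def)
    also have "\<dots> = (\<Sum>x\<in>A. u x * (\<Sum>y\<in>B. v y * f (delta x) (delta y) w))"
      using True w by (intro sum.cong refl arg_cong2[where f = "(*)"] linear_map_expand[OF V _ v])
        (auto simp: trilinear_form_def delta_car[OF U(1)])
    also have "\<dots> = (\<Sum>x\<in>A. u x * (\<Sum>y\<in>B. v y * (\<Sum>z\<in>C. w z * f (delta x) (delta y) (delta z))))"
      using True by (intro sum.cong refl arg_cong2[where f = "(*)"] linear_map_expand[OF W _ w])
        (auto simp: trilinear_form_def delta_car[OF U(1)] delta_car[OF V(1)])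
    also have "\<dots> = (\<Sum>(x, y, z)\<in>A \<times> B \<times> C. u x * v y * w z * f (delta x) (delta y) (delta z))"
      by (simp add: sum_distrib_left sum.cartesian_product mult.assoc case_prod_beta)
    finally show ?thesis using True
      by (simp add: ten3_def sum_fun_apply case_prod_beta)
  qed (simp add: ten3_def sum_fun_apply case_prod_beta)
qed

text \<open>The ground field is not a space of functions; its basis vector is 1, and the scalar
  moves out of the form as \<open>c * 1\<close>.\<close>

lemma ten2_ground_left_expand:
  assumes V: "is_supported V B" "finite B" and v: "v \<in> car V"
  shows "ten2 ground V c v = (\<Sum>y\<in>B. fscl (c * v y) (ten2 ground V 1 (delta y)))"
proof
  fix f
  show "ten2 ground V c v f = (\<Sum>y\<in>B. fscl (c * v y) (ten2 ground V 1 (delta y))) f"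
  proof (cases "bilinear_map ground V ground f")
    case True
    hence "linear_map ground ground (\<lambda>c. f c v)" "linear_map V ground (f 1)"
      using v by (auto simp: bilinear_map_def ground_def)
    hence "f (c * 1) v = c * f 1 v" "f 1 v = (\<Sum>y\<in>B. v y * f 1 (delta y))"
      using linear_map_expand[OF V _ v, of "f 1"]
      by (simp_all only: linear_map_def ground_def vspace.simps UNIV_I Ball_def simp_thms)
    with True show ?thesis
      by (simp add: ten2_def sum_fun_apply sum_distrib_left mult.assoc)
  qed (simp add: ten2_def sum_fun_apply)
qed

lemma ten2_ground_right_expand:
  assumes V: "is_supported V B" "finite B" and v: "v \<in> car V"
  shows "ten2 V ground v c = (\<Sum>y\<in>B. fscl (v y * c) (ten2 V ground (delta y) 1))"
proof
  fix f
  show "ten2 V ground v c f = (\<Sum>y\<in>B. fscl (v y * c) (ten2 V ground (delta y) 1)) f"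
  proof (cases "bilinear_map V ground ground f")
    case True
    hence "linear_map ground ground (f v)" "linear_map V ground (\<lambda>u. f u 1)"
      using v by (auto simp: bilinear_map_def ground_def)
    hence "f v (c * 1) = c * f v 1" "f v 1 = (\<Sum>y\<in>B. v y * f (delta y) 1)"
      using linear_map_expand[OF V _ v, of "\<lambda>u. f u 1"]
      by (simp_all only: linear_map_def ground_def vspace.simps UNIV_I Ball_def simp_thms)
    with True show ?thesis
      by (simp add: ten2_def sum_fun_apply sum_distrib_left mult_ac)
  qed (simp add: ten2_def sum_fun_apply)
qed


section \<open>Functions on a finite inverse property loop\<close>

text \<open>The coproduct is pull back along \<open>m\<close>, a function of two points being
  written in the basis of tensors of delta functions. These are formed over
  \<open>supported G\<close>, since the record cannot refer to itself; \<open>cop_H\<close> passes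
  to \<open>H\<close>.\<close>

definition loop_functions ::
  "'g set \<Rightarrow> ('g \<Rightarrow> 'g \<Rightarrow> 'g) \<Rightarrow> 'g \<Rightarrow> ('g \<Rightarrow> 'g) \<Rightarrow> ('k::field, 'g \<Rightarrow> 'k) coquasi" where
  "loop_functions G m e iv =
     \<lparr>car = {f. \<forall>g. g \<notin> G \<longrightarrow> f g = 0}, scl = fscl,
      mul = (\<lambda>f g. f * g),
      unt = (\<lambda>g. if g \<in> G then 1 else 0),
      cop = (\<lambda>h. \<Sum>x\<in>G. \<Sum>y\<in>G. fscl (h (m x y)) (ten2 (supported G) (supported G) (delta x) (delta y))),
      cou = (\<lambda>h. h e),
      ant = (\<lambda>h g. if g \<in> G then h (iv g) else 0)\<rparr>"

text \<open>\<open>H\<close> is a parameter tied to \<open>loop_functions\<close> by an equation, so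
  that an algebra introduced by other formulas can be substituted once the equation is
  proved.\<close>

locale finite_ip_loop =
  fixes G :: "'g set" and m :: "'g \<Rightarrow> 'g \<Rightarrow> 'g" (infixl "\<cdot>" 70) and e :: 'g and iv :: "'g \<Rightarrow> 'g"
    and H :: "('k::field, 'g \<Rightarrow> 'k) coquasi"
  assumes fin: "finite G"
    and mult_closed: "\<And>x y. x \<in> G \<Longrightarrow> y \<in> G \<Longrightarrow> x \<cdot> y \<in> G"
    and unit_closed: "e \<in> G"
    and left_unit: "\<And>x. x \<in> G \<Longrightarrow> e \<cdot> x = x"
    and right_unit: "\<And>x. x \<in> G \<Longrightarrow> x \<cdot> e = x"
    and inv_closed: "\<And>x. x \<in> G \<Longrightarrow> iv x \<in> G"
    and inv_left: "\<And>x y. x \<in> G \<Longrightarrow> y \<in> G \<Longrightarrow> iv x \<cdot> (x \<cdot> y) = y"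
    and inv_right: "\<And>x y. x \<in> G \<Longrightarrow> y \<in> G \<Longrightarrow> y \<cdot> iv x \<cdot> x = y"
    and H_def: "H = loop_functions G m e iv"
begin

text \<open>Evaluate \<open>iv (iv x) \<cdot> (iv x \<cdot> x)\<close> in two ways: cancelling
  \<open>iv x\<close> leaves \<open>x\<close>, and \<open>iv x \<cdot> x = e\<close> leaves
  \<open>iv (iv x)\<close>.\<close>

lemma inv_inv: assumes "x \<in> G" shows "iv (iv x) = x"
proof -
  have "iv x \<cdot> x = e" using inv_left[OF assms unit_closed] assms right_unit by simp
  thus ?thesis using inv_left[of "iv x" x] assms inv_closed right_unit by simp
qed

lemma inv_left': "x \<in> G \<Longrightarrow> y \<in> G \<Longrightarrow> x \<cdot> (iv x \<cdot> y) = y"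
  using inv_left[of "iv x" y] inv_inv inv_closed by simp

lemma inv_right': "x \<in> G \<Longrightarrow> y \<in> G \<Longrightarrow> y \<cdot> x \<cdot> iv x = y"
  using inv_right[of "iv x" y] inv_inv inv_closed by simp

lemma H_supported: "is_supported H G"
  by (simp add: H_def loop_functions_def is_supported_def)

lemmas H_car = car_supported[OF H_supported]
lemmas H_scl = scl_supported[OF H_supported]
lemmas H_delta = delta_car[OF H_supported]

lemma mul_H: "mul H f g = f * g"
  and unt_H: "unt H = (\<lambda>g. if g \<in> G then 1 else 0)"
  and cou_H: "cou H h = h e"
  and ant_H: "ant H h = (\<lambda>g. if g \<in> G then h (iv g) else 0)"
  by (simp_all add: H_def loop_functions_def)

text \<open>\<open>ten2\<close> sees its spaces only through carrier and scalar multiplication,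
  which \<open>supported G\<close> and \<open>H\<close> share.\<close>

lemma cop_H: "cop H h = (\<Sum>x\<in>G. \<Sum>y\<in>G. fscl (h (x \<cdot> y)) (ten2 H H (delta x) (delta y)))"
proof -
  have "ten2 (supported G) (supported G) = ten2 H H"
    by (intro ext)
      (simp add: ten2_def bilinear_map_def linear_map_def H_def loop_functions_def supported_def)
  thus ?thesis by (simp add: H_def loop_functions_def)
qed

lemma mul_car: "f \<in> car H \<Longrightarrow> mul H f g \<in> car H" "g \<in> car H \<Longrightarrow> mul H f g \<in> car H"
  and unt_car: "unt H \<in> car H"
  and ant_car: "ant H f \<in> car H"
  by (auto simp: H_car mul_H unt_H ant_H)

lemma mul_apply: "mul H f g x = f x * g x"
  and unt_apply: "x \<in> G \<Longrightarrow> unt H x = 1"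
  and ant_apply: "x \<in> G \<Longrightarrow> ant H h x = h (iv x)"
  by (simp_all add: mul_H unt_H ant_H)

text \<open>
  In Sweedler notation: evaluating the legs \<open>h\<^sub>(\<^sub>1\<^sub>)\<close> and \<open>h\<^sub>(\<^sub>2\<^sub>)\<close> at two points of the loop amounts
  to evaluating \<open>h\<close> at their product. All coalgebra identities reduce to this.
\<close>

lemma sweedler_eval:
  assumes P: "finite P" "\<And>p. p \<in> P \<Longrightarrow> \<alpha> p \<in> G" "\<And>p. p \<in> P \<Longrightarrow> \<beta> p \<in> G"
    and g: "\<And>u v. u \<in> car H \<Longrightarrow> v \<in> car H \<Longrightarrow> g u v = (\<Sum>p\<in>P. fscl (u (\<alpha> p) * v (\<beta> p)) (E p))"
  shows "sweedler (cop H h) g = (\<Sum>p\<in>P. fscl (h (\<alpha> p \<cdot> \<beta> p)) (E p))"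
proof
  fix f
  \<comment> \<open>Needed because a tensor takes the value 0 off the bilinear forms; bilinearity is
    read off from the expansion of \<open>g\<close>.\<close>
  have bil: "bilinear_map H H ground (\<lambda>u v. g u v f)"
    unfolding bilinear_map_def linear_map_def
    by (auto simp: g ground_def H_car H_scl sum_fun_apply algebra_simps sum.distrib sum_distrib_left)
  have "sweedler (cop H h) g f = (\<Sum>x\<in>G. \<Sum>y\<in>G. h (x \<cdot> y) * g (delta x) (delta y) f)"
    by (simp add: sweedler_def cop_H sum_fun_apply ten2_def bil)
  also have "\<dots> = (\<Sum>x\<in>G. \<Sum>y\<in>G. \<Sum>p\<in>P. h (x \<cdot> y) * (delta x (\<alpha> p) * delta y (\<beta> p) * E p f))"
    by (simp add: g H_delta sum_fun_apply sum_distrib_left)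
  also have "\<dots> = (\<Sum>x\<in>G. \<Sum>p\<in>P. \<Sum>y\<in>G. h (x \<cdot> y) * (delta x (\<alpha> p) * delta y (\<beta> p) * E p f))"
    by (intro sum.cong refl sum.swap)
  also have "\<dots> = (\<Sum>p\<in>P. \<Sum>x\<in>G. \<Sum>y\<in>G. h (x \<cdot> y) * (delta x (\<alpha> p) * delta y (\<beta> p) * E p f))"
    by (rule sum.swap)
  also have "\<dots> = (\<Sum>p\<in>P. h (\<alpha> p \<cdot> \<beta> p) * E p f)"
  proof (intro sum.cong refl)
    fix p assume p: "p \<in> P"
    have "(\<Sum>x\<in>G. \<Sum>y\<in>G. h (x \<cdot> y) * (delta x (\<alpha> p) * delta y (\<beta> p) * E p f))
        = (\<Sum>x\<in>G. \<Sum>y\<in>G. if \<beta> p = y then if \<alpha> p = x then h (x \<cdot> y) * E p f else 0 else 0)"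
      by (intro sum.cong refl) (auto simp: delta_def)
    thus "(\<Sum>x\<in>G. \<Sum>y\<in>G. h (x \<cdot> y) * (delta x (\<alpha> p) * delta y (\<beta> p) * E p f))
        = h (\<alpha> p \<cdot> \<beta> p) * E p f"
      using P p fin by simp
  qed
  finally show "sweedler (cop H h) g f = (\<Sum>p\<in>P. fscl (h (\<alpha> p \<cdot> \<beta> p)) (E p)) f"
    by (simp add: sum_fun_apply)
qed

text \<open>\<open>P\<close> indexes tensors \<open>E p\<close> of the target, and \<alpha>,
  \<beta>, \<gamma> give the points where the legs are evaluated. These may be equal or mutually
  inverse, which accommodates products with antipodes. The bracketing of the coproducts becomes that
  of the product.\<close>

lemma cop_left_eval:
  assumes P: "finite P" "\<And>p. p \<in> P \<Longrightarrow> \<alpha> p \<in> G" "\<And>p. p \<in> P \<Longrightarrow> \<beta> p \<in> G" "\<And>p. p \<in> P \<Longrightarrow> \<gamma> p \<in> G"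
    and g: "\<And>u v w. u \<in> car H \<Longrightarrow> v \<in> car H \<Longrightarrow> w \<in> car H \<Longrightarrow>
      g u v w = (\<Sum>p\<in>P. fscl (u (\<alpha> p) * v (\<beta> p) * w (\<gamma> p)) (E p))"
  shows "cop_left H h g = (\<Sum>p\<in>P. fscl (h (\<alpha> p \<cdot> \<beta> p \<cdot> \<gamma> p)) (E p))"
  unfolding cop_left_def
proof (rule sweedler_eval)
  fix u w assume "u \<in> car H" "w \<in> car H"
  \<comment> \<open>Inside, the leg \<open>w\<close> is constant and its value is absorbed into the
    target tensor.\<close>
  hence "sweedler (cop H u) (\<lambda>x y. g x y w)
      = (\<Sum>p\<in>P. fscl (u (\<alpha> p \<cdot> \<beta> p)) (fscl (w (\<gamma> p)) (E p)))"
    using P by (intro sweedler_eval) (auto simp: g fscl_fscl)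
  thus "sweedler (cop H u) (\<lambda>x y. g x y w) = (\<Sum>p\<in>P. fscl (u (\<alpha> p \<cdot> \<beta> p) * w (\<gamma> p)) (E p))"
    by (simp add: fscl_fscl)
qed (use P mult_closed in auto)

lemma cop_right_eval:
  assumes P: "finite P" "\<And>p. p \<in> P \<Longrightarrow> \<alpha> p \<in> G" "\<And>p. p \<in> P \<Longrightarrow> \<beta> p \<in> G" "\<And>p. p \<in> P \<Longrightarrow> \<gamma> p \<in> G"
    and g: "\<And>u v w. u \<in> car H \<Longrightarrow> v \<in> car H \<Longrightarrow> w \<in> car H \<Longrightarrow>
      g u v w = (\<Sum>p\<in>P. fscl (u (\<alpha> p) * v (\<beta> p) * w (\<gamma> p)) (E p))"
  shows "cop_right H h g = (\<Sum>p\<in>P. fscl (h (\<alpha> p \<cdot> (\<beta> p \<cdot> \<gamma> p))) (E p))"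
  unfolding cop_right_def
proof (rule sweedler_eval)
  fix u w assume "u \<in> car H" "w \<in> car H"
  hence "sweedler (cop H w) (\<lambda>x y. g u x y)
      = (\<Sum>p\<in>P. fscl (w (\<beta> p \<cdot> \<gamma> p)) (fscl (u (\<alpha> p)) (E p)))"
    using P by (intro sweedler_eval) (auto simp: g fscl_fscl mult_ac)
  thus "sweedler (cop H w) (\<lambda>x y. g u x y) = (\<Sum>p\<in>P. fscl (u (\<alpha> p) * w (\<beta> p \<cdot> \<gamma> p)) (E p))"
    by (simp add: fscl_fscl mult_ac)
qed (use P mult_closed in auto)

abbreviation "basis2 \<equiv> \<lambda>p. ten2 H H (delta (fst p)) (delta (snd p))"
abbreviation "basis3 \<equiv> \<lambda>p. ten3 H H H (delta (fst p)) (delta (fst (snd p))) (delta (snd (snd p)))"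

lemma ten2_H: "u \<in> car H \<Longrightarrow> v \<in> car H \<Longrightarrow>
    ten2 H H u v = (\<Sum>p\<in>G \<times> G. fscl (u (fst p) * v (snd p)) (basis2 p))"
  using ten2_expand[OF H_supported fin H_supported fin] by (simp add: case_prod_beta)

lemma ten3_H: "u \<in> car H \<Longrightarrow> v \<in> car H \<Longrightarrow> w \<in> car H \<Longrightarrow>
    ten3 H H H u v w = (\<Sum>p\<in>G \<times> G \<times> G. fscl (u (fst p) * v (fst (snd p)) * w (snd (snd p))) (basis3 p))"
  using ten3_expand[OF H_supported fin H_supported fin H_supported fin] by (simp add: case_prod_beta)

lemma cop_H_basis: "cop H h = (\<Sum>p\<in>G \<times> G. fscl (h (fst p \<cdot> snd p)) (basis2 p))"
  by (simp add: cop_H sum.cartesian_product case_prod_beta)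

section \<open>The Hopf coquasigroup axioms\<close>

lemma algebra_H: "unital_assoc_algebra H"
  unfolding unital_assoc_algebra_def
  by (auto simp: is_vspace_supported[OF H_supported] bilinear_map_def linear_map_def H_car H_scl
      mul_H unt_H fun_eq_iff algebra_simps)

lemma counit_H: "counit_alg_hom H"
  by (auto simp: counit_alg_hom_def linear_map_def H_car H_scl ground_def cou_H mul_H unt_H unit_closed)

lemma coproduct_H: "coproduct_alg_hom H"
  unfolding coproduct_alg_hom_def
proof (intro conjI ballI)
  interpret T: vector_space "fscl :: 'k \<Rightarrow> ('k, 'g \<Rightarrow> 'k, 'g \<Rightarrow> 'k) tensor2 \<Rightarrow> _"
    by (rule vector_space_fscl)
  show "linear_map H (tensor_space H H) (cop H)"
    unfolding linear_map_def
  proof (intro conjI ballI allI)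
    fix h show "cop H h \<in> car (tensor_space H H)"
      unfolding tensor_space_def tensor_span_def cop_H_basis vspace.simps
      by (intro T.span_sum T.span_scale T.span_base CollectI exI conjI refl) (auto intro: H_delta)
  qed (auto simp: cop_H_basis tensor_space_def H_scl fun_eq_iff sum_fun_apply algebra_simps
      sum.distrib sum_distrib_left)
  show "cop H (unt H) = ten2 H H (unt H) (unt H)"
    by (auto simp: ten2_H unt_car cop_H_basis unt_apply mult_closed intro!: sum.cong)
  fix g h
  \<comment> \<open>Both sides have the value g(xy) h(xy) at (x, y). The outer coproduct treats the
    values of \<open>h\<close> as part of the tensor, the inner one those of \<open>g1\<close> and
    \<open>g2\<close>.\<close>
  have "sweedler (cop H g) (\<lambda>g1 g2. sweedler (cop H h) (\<lambda>h1 h2. ten2 H H (mul H g1 h1) (mul H g2 h2)))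
      = (\<Sum>p\<in>G \<times> G. fscl (g (fst p \<cdot> snd p)) (fscl (h (fst p \<cdot> snd p)) (basis2 p)))"
  proof (rule sweedler_eval)
    fix g1 g2 assume g: "g1 \<in> car H" "g2 \<in> car H"
    have "sweedler (cop H h) (\<lambda>h1 h2. ten2 H H (mul H g1 h1) (mul H g2 h2))
      = (\<Sum>p\<in>G \<times> G. fscl (h (fst p \<cdot> snd p)) (fscl (g1 (fst p) * g2 (snd p)) (basis2 p)))"
      by (rule sweedler_eval) (auto simp: fin ten2_H mul_car g mul_apply fscl_fscl mult_ac)
    thus "sweedler (cop H h) (\<lambda>h1 h2. ten2 H H (mul H g1 h1) (mul H g2 h2)) =
        (\<Sum>p\<in>G \<times> G. fscl (g1 (fst p) * g2 (snd p)) (fscl (h (fst p \<cdot> snd p)) (basis2 p)))"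
      by (simp add: fscl_fscl mult_ac)
  qed (auto simp: fin)
  thus "cop H (mul H g h) =
      sweedler (cop H g) (\<lambda>g1 g2. sweedler (cop H h) (\<lambda>h1 h2. ten2 H H (mul H g1 h1) (mul H g2 h2)))"
    by (simp add: cop_H_basis mul_H fscl_fscl)
qed

lemma counital_H: "counital H"
  unfolding counital_def
proof (intro ballI conjI)
  fix h assume h: "h \<in> car H"
  \<comment> \<open>The first leg is evaluated at the constant point \<open>e\<close>, so the index
    set is \<open>G\<close> alone.\<close>
  have "sweedler (cop H h) (\<lambda>h1 h2. ten2 ground H (cou H h1) h2)
      = (\<Sum>y\<in>G. fscl (h (e \<cdot> y)) (ten2 ground H 1 (delta y)))"
    by (rule sweedler_eval)
      (auto simp: fin unit_closed cou_H ten2_ground_left_expand[OF H_supported fin])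
  thus "sweedler (cop H h) (\<lambda>h1 h2. ten2 ground H (cou H h1) h2) = ten2 ground H 1 h"
    by (simp add: ten2_ground_left_expand[OF H_supported fin h, of 1] left_unit)
  have "sweedler (cop H h) (\<lambda>h1 h2. ten2 H ground h1 (cou H h2))
      = (\<Sum>y\<in>G. fscl (h (y \<cdot> e)) (ten2 H ground (delta y) 1))"
    by (rule sweedler_eval)
      (auto simp: fin unit_closed cou_H ten2_ground_right_expand[OF H_supported fin])
  thus "sweedler (cop H h) (\<lambda>h1 h2. ten2 H ground h1 (cou H h2)) = ten2 H ground h 1"
    by (simp add: ten2_ground_right_expand[OF H_supported fin h, of 1] right_unit)
qed

text \<open>At (x, y) the four antipode identities reduce to iv x (x y) = y, x (iv x y) = y, (x iv
  y) y = x and (x y) iv y = x; the unit of the tensor stands in the leg of the point that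
  cancels.\<close>

lemma hopf_coquasigroup_H: "hopf_coquasigroup H"
  unfolding hopf_coquasigroup_def
proof (intro conjI ballI)
  show "linear_map H H (ant H)"
    using ant_car by (auto simp: linear_map_def H_scl ant_H fun_eq_iff)
  fix h assume h: "h \<in> car H"
  have "cop_right H h (\<lambda>h1 h21 h22. ten2 H H (mul H (ant H h1) h21) h22)
      = (\<Sum>p\<in>G \<times> G. fscl (h (iv (fst p) \<cdot> (fst p \<cdot> snd p))) (basis2 p))"
    by (rule cop_right_eval)
      (auto simp: fin inv_closed ten2_H mul_car ant_car ant_apply mul_apply intro!: sum.cong)
  also have "\<dots> = ten2 H H (unt H) h"
    by (auto simp: ten2_H unt_car h unt_apply inv_left intro!: sum.cong)
  finally show "cop_right H h (\<lambda>h1 h21 h22. ten2 H H (mul H (ant H h1) h21) h22) = \<dots>" .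
  have "cop_right H h (\<lambda>h1 h21 h22. ten2 H H (mul H h1 (ant H h21)) h22)
      = (\<Sum>p\<in>G \<times> G. fscl (h (fst p \<cdot> (iv (fst p) \<cdot> snd p))) (basis2 p))"
    by (rule cop_right_eval)
      (auto simp: fin inv_closed ten2_H mul_car ant_car ant_apply mul_apply intro!: sum.cong)
  also have "\<dots> = ten2 H H (unt H) h"
    by (auto simp: ten2_H unt_car h unt_apply inv_left' intro!: sum.cong)
  finally show "cop_right H h (\<lambda>h1 h21 h22. ten2 H H (mul H h1 (ant H h21)) h22) = \<dots>" .
  have "cop_left H h (\<lambda>h11 h12 h2. ten2 H H h11 (mul H (ant H h12) h2))
      = (\<Sum>p\<in>G \<times> G. fscl (h (fst p \<cdot> iv (snd p) \<cdot> snd p)) (basis2 p))"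
    by (rule cop_left_eval)
      (auto simp: fin inv_closed ten2_H mul_car ant_car ant_apply mul_apply mult_ac intro!: sum.cong)
  also have "\<dots> = ten2 H H h (unt H)"
    by (auto simp: ten2_H unt_car h unt_apply inv_right intro!: sum.cong)
  finally show "cop_left H h (\<lambda>h11 h12 h2. ten2 H H h11 (mul H (ant H h12) h2)) = \<dots>" .
  have "cop_left H h (\<lambda>h11 h12 h2. ten2 H H h11 (mul H h12 (ant H h2)))
      = (\<Sum>p\<in>G \<times> G. fscl (h (fst p \<cdot> snd p \<cdot> iv (snd p))) (basis2 p))"
    by (rule cop_left_eval)
      (auto simp: fin inv_closed ten2_H mul_car ant_car ant_apply mul_apply mult_ac intro!: sum.cong)
  also have "\<dots> = ten2 H H h (unt H)"
    by (auto simp: ten2_H unt_car h unt_apply inv_right' intro!: sum.cong)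
  finally show "cop_left H h (\<lambda>h11 h12 h2. ten2 H H h11 (mul H h12 (ant H h2))) = \<dots>" .
qed (fact algebra_H coproduct_H counit_H counital_H)+

section \<open>Coassociativity and the coassociator\<close>

lemma hopf_algebra_H:
  assumes assoc: "\<And>x y z. x \<in> G \<Longrightarrow> y \<in> G \<Longrightarrow> z \<in> G \<Longrightarrow> x \<cdot> y \<cdot> z = x \<cdot> (y \<cdot> z)"
  shows "hopf_algebra H"
  unfolding hopf_algebra_def
proof (intro conjI ballI)
  fix h
  have "cop_left H h (ten3 H H H)
      = (\<Sum>p\<in>G \<times> G \<times> G. fscl (h (fst p \<cdot> fst (snd p) \<cdot> snd (snd p))) (basis3 p))"
    by (rule cop_left_eval) (auto simp: fin ten3_H)
  moreover have "cop_right H h (ten3 H H H)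
      = (\<Sum>p\<in>G \<times> G \<times> G. fscl (h (fst p \<cdot> (fst (snd p) \<cdot> snd (snd p)))) (basis3 p))"
    by (rule cop_right_eval) (auto simp: fin ten3_H)
  ultimately show "cop_left H h (ten3 H H H) = cop_right H h (ten3 H H H)"
    by (auto simp: assoc intro!: sum.cong)
qed (fact hopf_coquasigroup_H)

text \<open>Multiplying legs evaluates both triple coproducts at one triple (x, y, z): the first leg
  at x(yz) and the antipode of the second at (xy)z, hence the second leg at the inverse of
  (xy)z.\<close>

lemma coassociator_H:
  "coassociator H h = (\<Sum>p\<in>G \<times> G \<times> G. fscl (h (fst p \<cdot> (fst (snd p) \<cdot> snd (snd p))
     \<cdot> iv (fst p \<cdot> fst (snd p) \<cdot> snd (snd p)))) (basis3 p))"
  unfolding coassociator_def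
proof (rule sweedler_eval)
  let ?P = "G \<times> G \<times> G"
  let ?a = "\<lambda>p. fst p" and ?b = "\<lambda>p. fst (snd p)" and ?c = "\<lambda>p. snd (snd p)"
  fix u v assume "u \<in> car H" "v \<in> car H"
  have "cop_right H u (\<lambda>x y z. cop_left H (ant H v) (\<lambda>p q r.
      ten3 H H H (mul H x p) (mul H y q) (mul H z r)))
    = (\<Sum>p\<in>?P. fscl (u (?a p \<cdot> (?b p \<cdot> ?c p))) (fscl (ant H v (?a p \<cdot> ?b p \<cdot> ?c p)) (basis3 p)))"
  proof (rule cop_right_eval)
    fix x y z assume xyz: "x \<in> car H" "y \<in> car H" "z \<in> car H"
    have "cop_left H (ant H v) (\<lambda>p q r. ten3 H H H (mul H x p) (mul H y q) (mul H z r))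
      = (\<Sum>p\<in>?P. fscl (ant H v (?a p \<cdot> ?b p \<cdot> ?c p)) (fscl (x (?a p) * y (?b p) * z (?c p)) (basis3 p)))"
      by (rule cop_left_eval) (auto simp: fin ten3_H mul_car xyz mul_apply fscl_fscl mult_ac)
    thus "cop_left H (ant H v) (\<lambda>p q r. ten3 H H H (mul H x p) (mul H y q) (mul H z r))
      = (\<Sum>p\<in>?P. fscl (x (?a p) * y (?b p) * z (?c p)) (fscl (ant H v (?a p \<cdot> ?b p \<cdot> ?c p)) (basis3 p)))"
      by (simp add: fscl_fscl mult_ac)
  qed (auto simp: fin)
  thus "cop_right H u (\<lambda>x y z. cop_left H (ant H v) (\<lambda>p q r.
      ten3 H H H (mul H x p) (mul H y q) (mul H z r)))
    = (\<Sum>p\<in>?P. fscl (u (?a p \<cdot> (?b p \<cdot> ?c p)) * v (iv (?a p \<cdot> ?b p \<cdot> ?c p))) (basis3 p))"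
    by (auto simp: fscl_fscl ant_H mult_closed intro!: sum.cong)
qed (auto simp: fin mult_closed inv_closed)

end


section \<open>Nuclear normal subloops containing all associators\<close>

text \<open>The subloop has a product of its own because \<open>cayley_mult 0\<close> and
  \<open>cayley_mult n\<close> need agree only on the signs.\<close>

locale finite_ip_loop_nuclear = finite_ip_loop G m e iv H
  for G :: "'g set" and m (infixl "\<cdot>" 70) and e iv and H :: "('k::field, 'g \<Rightarrow> 'k) coquasi" +
  fixes Z :: "'g set" and m\<^sub>Z :: "'g \<Rightarrow> 'g \<Rightarrow> 'g" and iv\<^sub>Z :: "'g \<Rightarrow> 'g"
    and C :: "('k::field, 'g \<Rightarrow> 'k) coquasi"
  assumes sub: "Z \<subseteq> G"
    and Z_loop: "finite_ip_loop Z m\<^sub>Z e iv\<^sub>Z C"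
    and Z_mult: "\<And>x y. x \<in> Z \<Longrightarrow> y \<in> Z \<Longrightarrow> m\<^sub>Z x y = x \<cdot> y"
    and nuclear: "\<And>x y z. x \<in> G \<Longrightarrow> y \<in> G \<Longrightarrow> z \<in> G \<Longrightarrow> x \<in> Z \<or> y \<in> Z \<or> z \<in> Z \<Longrightarrow>
      x \<cdot> y \<cdot> z = x \<cdot> (y \<cdot> z)"
    and normal: "\<And>x y. x \<in> G \<Longrightarrow> y \<in> Z \<Longrightarrow> x \<cdot> y \<cdot> iv x \<in> Z"
    and associators: "\<And>x y z. x \<in> G \<Longrightarrow> y \<in> G \<Longrightarrow> z \<in> G \<Longrightarrow> x \<cdot> (y \<cdot> z) \<cdot> iv (x \<cdot> y \<cdot> z) \<in> Z"
begin

interpretation Z: finite_ip_loop Z m\<^sub>Z e iv\<^sub>Z C by (fact Z_loop)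

lemma Z_closed: "x \<in> Z \<Longrightarrow> y \<in> Z \<Longrightarrow> x \<cdot> y \<in> Z"
  using Z.mult_closed Z_mult by metis

definition res :: "('g \<Rightarrow> 'k) \<Rightarrow> 'g \<Rightarrow> 'k" where
  "res f = (\<lambda>g. if g \<in> Z then f g else 0)"

lemma res_car: "res f \<in> car C"
  by (simp add: Z.H_car res_def)

lemma res_apply: "z \<in> Z \<Longrightarrow> res f z = f z"
  by (simp add: res_def)

lemma res_unt: "res (unt H) = unt C"
  using sub by (auto simp: res_def unt_H Z.unt_H fun_eq_iff)

lemma ker_res: "ker_on H res = {f \<in> car H. \<forall>z\<in>Z. f z = 0}"
  by (auto simp: ker_on_def res_def fun_eq_iff)

section \<open>Restriction as a morphism and as a coassociative pair\<close>

lemma morphism_res: "coquasi_morphism H C res"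
  unfolding coquasi_morphism_def
proof (intro conjI ballI)
  show "linear_map H C res"
    using res_car by (auto simp: linear_map_def H_scl Z.H_scl res_def fun_eq_iff)
  fix b
  \<comment> \<open>Restricted legs have coordinates only at points of \<open>Z\<close>. As
    \<open>Z\<close> is closed under the product, \<open>b\<close> and \<open>res b\<close> agree at
    the products that occur.\<close>
  have "sweedler (cop H b) (\<lambda>b1 b2. ten2 C C (res b1) (res b2))
      = (\<Sum>p\<in>Z \<times> Z. fscl (b (fst p \<cdot> snd p)) (Z.basis2 p))"
    using sub by (intro sweedler_eval) (auto simp: Z.fin Z.ten2_H res_car res_apply intro!: sum.cong)
  also have "\<dots> = cop C (res b)"
    by (auto simp: Z.cop_H_basis res_apply Z_mult Z_closed intro!: sum.cong)
  finally show "sweedler (cop H b) (\<lambda>b1 b2. ten2 C C (res b1) (res b2)) = cop C (res b)" .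
  show "res (unt H) = unt C" by (fact res_unt)
qed (auto simp: mul_H Z.mul_H cou_H Z.cou_H Z.unit_closed res_def fun_eq_iff)

text \<open>Restricting a leg confines its coordinate to \<open>Z\<close>; then one of the three
  factors is nuclear and the two bracketings coincide. This is carried out for each leg in
  turn.\<close>

lemma coassociative_pair_res: "coassociative_pair C H res"
  unfolding coassociative_pair_def
proof (intro conjI ballI)
  show "hopf_algebra C"
    by (rule Z.hopf_algebra_H) (use nuclear sub in \<open>simp add: Z_mult Z_closed subset_iff\<close>)
  fix b assume "b \<in> car H"
  let ?a = "\<lambda>p. fst p" and ?b = "\<lambda>p. fst (snd p)" and ?c = "\<lambda>p. snd (snd p)"
  note expand = ten3_expand[OF Z.H_supported Z.fin H_supported fin H_supported fin]
    ten3_expand[OF H_supported fin Z.H_supported Z.fin H_supported fin]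
    ten3_expand[OF H_supported fin H_supported fin Z.H_supported Z.fin]
  have "cop_left H b (\<lambda>x y z. ten3 C H H (res x) y z)
      = (\<Sum>p\<in>Z \<times> G \<times> G. fscl (b (?a p \<cdot> ?b p \<cdot> ?c p)) (ten3 C H H (delta (?a p)) (delta (?b p)) (delta (?c p))))"
    using sub by (intro cop_left_eval) (auto simp: Z.fin fin expand res_car res_apply intro!: sum.cong)
  also have "\<dots> = (\<Sum>p\<in>Z \<times> G \<times> G. fscl (b (?a p \<cdot> (?b p \<cdot> ?c p))) (ten3 C H H (delta (?a p)) (delta (?b p)) (delta (?c p))))"
    using sub by (intro sum.cong refl) (auto simp: nuclear)
  also have "\<dots> = cop_right H b (\<lambda>x y z. ten3 C H H (res x) y z)"
    using sub by (intro cop_right_eval[symmetric]) (auto simp: Z.fin fin expand res_car res_apply intro!: sum.cong)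
  finally show "cop_left H b (\<lambda>x y z. ten3 C H H (res x) y z) = \<dots>" .
  have "cop_left H b (\<lambda>x y z. ten3 H C H x (res y) z)
      = (\<Sum>p\<in>G \<times> Z \<times> G. fscl (b (?a p \<cdot> ?b p \<cdot> ?c p)) (ten3 H C H (delta (?a p)) (delta (?b p)) (delta (?c p))))"
    using sub by (intro cop_left_eval) (auto simp: Z.fin fin expand res_car res_apply intro!: sum.cong)
  also have "\<dots> = (\<Sum>p\<in>G \<times> Z \<times> G. fscl (b (?a p \<cdot> (?b p \<cdot> ?c p))) (ten3 H C H (delta (?a p)) (delta (?b p)) (delta (?c p))))"
    using sub by (intro sum.cong refl) (auto simp: nuclear)
  also have "\<dots> = cop_right H b (\<lambda>x y z. ten3 H C H x (res y) z)"
    using sub by (intro cop_right_eval[symmetric]) (auto simp: Z.fin fin expand res_car res_apply intro!: sum.cong)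
  finally show "cop_left H b (\<lambda>x y z. ten3 H C H x (res y) z) = \<dots>" .
  have "cop_left H b (\<lambda>x y z. ten3 H H C x y (res z))
      = (\<Sum>p\<in>G \<times> G \<times> Z. fscl (b (?a p \<cdot> ?b p \<cdot> ?c p)) (ten3 H H C (delta (?a p)) (delta (?b p)) (delta (?c p))))"
    using sub by (intro cop_left_eval) (auto simp: Z.fin fin expand res_car res_apply intro!: sum.cong)
  also have "\<dots> = (\<Sum>p\<in>G \<times> G \<times> Z. fscl (b (?a p \<cdot> (?b p \<cdot> ?c p))) (ten3 H H C (delta (?a p)) (delta (?b p)) (delta (?c p))))"
    using sub by (intro sum.cong refl) (auto simp: nuclear)
  also have "\<dots> = cop_right H b (\<lambda>x y z. ten3 H H C x y (res z))"
    using sub by (intro cop_right_eval[symmetric]) (auto simp: Z.fin fin expand res_car res_apply intro!: sum.cong)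
  finally show "cop_left H b (\<lambda>x y z. ten3 H H C x y (res z)) = \<dots>" .
qed (fact hopf_coquasigroup_H morphism_res)+

section \<open>The three conditions of quasi coassociativity\<close>

text \<open>The test for condition (2): for y outside \<open>Z\<close> the function
  \<open>delta y\<close> restricts to 0, so the basis tensor belongs to the spanning set; for y in
  \<open>Z\<close> the coefficient vanishes.\<close>

lemma basis2_sum_in_span:
  assumes "\<And>x y. x \<in> G \<Longrightarrow> y \<in> Z \<Longrightarrow> \<phi> (x, y) = 0"
  shows "(\<Sum>p\<in>G \<times> G. fscl (\<phi> p) (basis2 p)) \<in> tensor_span H H (car H) (ker_on H res)"
proof -
  interpret T: vector_space "fscl :: 'k \<Rightarrow> ('k, 'g \<Rightarrow> 'k, 'g \<Rightarrow> 'k) tensor2 \<Rightarrow> _"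
    by (rule vector_space_fscl)
  show ?thesis
    unfolding tensor_span_def
  proof (rule T.span_sum)
    fix p assume p: "p \<in> G \<times> G"
    show "fscl (\<phi> p) (basis2 p) \<in> T.span {ten2 H H a b |a b. a \<in> car H \<and> b \<in> ker_on H res}"
    proof (cases "snd p \<in> Z")
      case True
      hence "\<phi> p = 0" using assms[of "fst p" "snd p"] p by auto
      thus ?thesis by (simp add: T.span_zero)
    next
      case False
      hence "delta (snd p) \<in> ker_on H res"
        using p by (auto simp: ker_res H_delta) (auto simp: delta_def)
      hence "\<exists>a b. basis2 p = ten2 H H a b \<and> a \<in> car H \<and> b \<in> ker_on H res"
        using p by (intro exI conjI refl) (auto intro: H_delta)
      thus ?thesis by (intro T.span_scale T.span_base) blast
    qed
  qed
qed

theorem quasi_coassociative_res: "quasi_coassociative C H res"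
  unfolding quasi_coassociative_def
proof (intro conjI ballI)
  show "res ` car H = car C"
  proof (intro set_eqI iffI)
    fix f assume f: "f \<in> car C"
    \<comment> \<open>Functions on \<open>Z\<close> are already extended by 0, so each is its own
      preimage.\<close>
    hence "res f = f" by (auto simp: Z.H_car res_def)
    moreover have "f \<in> car H" using f sub by (auto simp: Z.H_car H_car)
    ultimately show "f \<in> res ` car H" by (metis imageI)
  qed (use res_car in auto)
  show "ker_on H res \<subseteq> ker_on H (coassociator H)"
  proof
    fix b assume b: "b \<in> ker_on H res"
    \<comment> \<open>Every point at which \<open>b\<close> is evaluated lies in \<open>Z\<close> by
      \<open>associators\<close>, and \<open>b\<close> vanishes there.\<close>
    hence "coassociator H b = 0"
      by (auto simp: ker_res coassociator_H associators fun_eq_iff sum_fun_apply intro!: sum.neutral)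
    with b show "b \<in> ker_on H (coassociator H)" by (simp add: ker_on_def)
  qed
  fix i assume i: "i \<in> ker_on H res"
  hence i0: "i z = 0" if "z \<in> Z" for z using that by (simp add: ker_res)
  \<comment> \<open>The first and last legs meet at x, the last through the antipode, so
    \<open>i\<close> is evaluated at the conjugate of y by x, which stays in \<open>Z\<close> for y
    in \<open>Z\<close>.\<close>
  have "cop_left H i (\<lambda>i11 i12 i2. ten2 H H (mul H i11 (ant H i2)) i12)
      = (\<Sum>p\<in>G \<times> G. fscl (i (fst p \<cdot> snd p \<cdot> iv (fst p))) (basis2 p))"
    by (rule cop_left_eval)
      (auto simp: fin inv_closed ten2_H mul_car ant_car ant_apply mul_apply mult_ac intro!: sum.cong)
  thus "cop_left H i (\<lambda>i11 i12 i2. ten2 H H (mul H i11 (ant H i2)) i12)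
      \<in> tensor_span H H (car H) (ker_on H res)"
    by (simp add: basis2_sum_in_span i0 normal)
  have "cop_right H i (\<lambda>i1 i21 i22. ten2 H H (mul H i1 (ant H i22)) i21)
      = (\<Sum>p\<in>G \<times> G. fscl (i (fst p \<cdot> (snd p \<cdot> iv (fst p)))) (basis2 p))"
    by (rule cop_right_eval)
      (auto simp: fin inv_closed ten2_H mul_car ant_car ant_apply mul_apply mult_ac intro!: sum.cong)
  \<comment> \<open>The conjugate is now bracketed the other way; nuclearity of y reduces it to the
    first case.\<close>
  moreover have "x \<cdot> (y \<cdot> iv x) \<in> Z" if "x \<in> G" "y \<in> Z" for x y
    using normal[OF that] nuclear[of x y "iv x"] that sub inv_closed by auto
  ultimately show "cop_right H i (\<lambda>i1 i21 i22. ten2 H H (mul H i1 (ant H i22)) i21)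
      \<in> tensor_span H H (car H) (ker_on H res)"
    by (simp add: basis2_sum_in_span i0)
qed (fact coassociative_pair_res)

end


section \<open>The basis quasigroup\<close>

lemma bit_add_self: "(i::bit) + i = 0"
  by (cases "i = 0") auto

lemma bvec_add_self: "(a::bvec) + a = 0"
  by (simp add: fun_eq_iff bit_add_self)

lemma bvec_add_eq_0_iff: "(a::bvec) + b = 0 \<longleftrightarrow> b = a"
  by (metis add.assoc add.right_neutral add_0 bvec_add_self)

lemma zero_Z2n: "0 \<in> Z2n n"
  by (simp add: Z2n_def)

lemma Z2n_0: "Z2n 0 = {0}"
  by (auto simp: Z2n_def)

lemma UNIV_bit: "(UNIV :: bit set) = {0, 1}"
  by (auto intro: bit.exhaust)

lemma finite_bit: "finite (UNIV :: bit set)"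
  by (simp add: UNIV_bit)

lemma loop_cases:
  assumes "g \<in> basis_loop n"
  obtains a i where "a \<in> Z2n n" "g = sgn_basis a i"
  using assms by (auto simp: basis_loop_def)

lemma sgn_basis_loop: "a \<in> Z2n n \<Longrightarrow> sgn_basis a i \<in> basis_loop n"
  by (auto simp: basis_loop_def)

lemma finite_basis_loop: "finite (basis_loop n :: (bvec \<Rightarrow> 'k::field) set)"
proof -
  have "(basis_loop n :: (bvec \<Rightarrow> 'k) set) = (\<lambda>(a, i). sgn_basis a i) ` (Z2n n \<times> UNIV)"
    by (auto simp: basis_loop_def)
  thus ?thesis by (simp only: finite_imageI finite_cartesian_product finite_Z2n finite_bit)
qed

lemma sum_delta_index:
  assumes "a \<in> Z2n n"
  shows "(\<Sum>b\<in>Z2n n. \<Sum>j\<in>UNIV. if b = a \<and> j = (i::bit) then f b j else 0) = f a i"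
proof -
  have "(\<Sum>b\<in>Z2n n. \<Sum>j\<in>UNIV. if b = a \<and> j = i then f b j else 0)
      = (\<Sum>b\<in>Z2n n. if b = a then (\<Sum>j\<in>UNIV. if j = i then f b j else 0) else 0)"
    by (intro sum.cong) auto
  thus ?thesis using assms by (simp add: finite_Z2n finite_bit)
qed

text \<open>For \<open>g = e_a\<close> or \<open>g = -e_a\<close> the square of \<open>g\<close> is \<open>F(a,a) e_0\<close>, hence the scalar.\<close>

definition cayley_inv :: "nat \<Rightarrow> (bvec \<Rightarrow> bvec \<Rightarrow> 'k::field) \<Rightarrow> (bvec \<Rightarrow> 'k) \<Rightarrow> bvec \<Rightarrow> 'k" where
  "cayley_inv n F g = fscl (cayley_mult n F g g 0) g"

section \<open>Signs, products and inverses in coordinates\<close>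

locale cayley_loop =
  fixes n :: nat and F :: "bvec \<Rightarrow> bvec \<Rightarrow> 'k::field"
  assumes two: "(1::'k) \<noteq> - 1"
    and cochain: "unital_cochain n F"
    and Q: "quasigroup (basis_loop n) (cayley_mult n F) (sgn_basis 0 0)"
begin

abbreviation u :: "bvec \<Rightarrow> bit \<Rightarrow> bvec \<Rightarrow> 'k" where "u \<equiv> sgn_basis"

text \<open>In characteristic other than 2 the elements e_a and -e_a differ, so pairs (a, i) index
  the loop injectively.\<close>

lemmas u_inj = sgn_basis_inj[OF two]

text \<open>The values of \<open>F\<close> are signs, \<open>F a b = (-1)\<^sup>\<sigma>\<close> with \<open>\<sigma> = \<sigma> a b\<close>.\<close>

definition \<sigma> :: "bvec \<Rightarrow> bvec \<Rightarrow> bit" where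
  "\<sigma> a b = (if F a b = 1 then 0 else 1)"

text \<open>Closure of the loop under the product forces \<open>F a b\<close> to be 1 or -1, so
  scaling by it only shifts the sign exponent.\<close>

lemma fscl_F: "a \<in> Z2n n \<Longrightarrow> b \<in> Z2n n \<Longrightarrow> fscl (F a b) (u c i) = u c (i + \<sigma> a b)"
  using cochain_sign[OF Q, of a b] by (auto simp: \<sigma>_def sgn_basis_def fun_eq_iff)

lemma inverse_F: "a \<in> Z2n n \<Longrightarrow> b \<in> Z2n n \<Longrightarrow> inverse (F a b) = F a b"
  using cochain_sign[OF Q, of a b] by auto

lemma F_F: "a \<in> Z2n n \<Longrightarrow> b \<in> Z2n n \<Longrightarrow> F a b * F a b = 1"
  using cochain_sign[OF Q, of a b] by auto

lemma sigma_unit: "a \<in> Z2n n \<Longrightarrow> \<sigma> a 0 = 0" "a \<in> Z2n n \<Longrightarrow> \<sigma> 0 a = 0"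
  using cochain by (auto simp: unital_cochain_def \<sigma>_def)

lemma u_mult:
  "a \<in> Z2n n \<Longrightarrow> b \<in> Z2n n \<Longrightarrow> cayley_mult n F (u a i) (u b j) = u (a + b) (i + j + \<sigma> a b)"
  by (simp add: sgn_basis_mult fscl_F)

lemma u_inv: assumes "a \<in> Z2n n" shows "cayley_inv n F (u a i) = u a (i + \<sigma> a a)"
proof -
  \<comment> \<open>The two equal signs cancel and a + a = 0, so the square is F(a,a) e_0.\<close>
  have "cayley_mult n F (u a i) (u a i) 0 = F a a"
    using assms by (simp add: sgn_basis_mult bit_add_self bvec_add_self)
      (simp add: sgn_basis_def cayley_basis_def)
  thus ?thesis using assms by (simp add: cayley_inv_def fscl_F)
qed

text \<open>Indices give b + a = 0, hence b = a, and comparing sign exponents then determines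
  j.\<close>

lemma inverse_unique:
  assumes "a \<in> Z2n n" "b \<in> Z2n n" "cayley_mult n F (u b j) (u a i) = u 0 0"
  shows "u b j = cayley_inv n F (u a i)"
proof -
  have "b = a" and s: "j + i + \<sigma> b a = 0"
    using assms by (auto simp: u_mult u_inj bvec_add_eq_0_iff)
  moreover have "j = i + \<sigma> a a"
    using s \<open>b = a\<close> by (cases "i = 0"; cases "j = 0"; cases "\<sigma> a a = 0") auto
  ultimately show ?thesis using assms by (simp add: u_inv)
qed

text \<open>The quasigroup provides only some inverse of g. Its second law at the identity makes it
  a left inverse, and uniqueness identifies it with the explicit formula.\<close>

lemma inverse_laws:
  assumes g: "g \<in> basis_loop n" and h: "h \<in> basis_loop n"
  shows "cayley_mult n F (cayley_inv n F g) (cayley_mult n F g h) = h"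
    and "cayley_mult n F (cayley_mult n F h (cayley_inv n F g)) g = h"
proof -
  obtain g' where g': "g' \<in> basis_loop n"
    "\<And>h. h \<in> basis_loop n \<Longrightarrow> cayley_mult n F g' (cayley_mult n F g h) = h"
    "\<And>h. h \<in> basis_loop n \<Longrightarrow> cayley_mult n F (cayley_mult n F h g') g = h"
    using Q g unfolding quasigroup_def by blast
  have "u 0 0 \<in> basis_loop n" "cayley_mult n F (u 0 0) g' = g'"
    using Q g'(1) unfolding quasigroup_def by auto
  hence "cayley_mult n F g' g = u 0 0" using g'(3) by metis
  moreover obtain a i where "a \<in> Z2n n" "g = u a i" using g by (rule loop_cases)
  moreover obtain b j where "b \<in> Z2n n" "g' = u b j" using g'(1) by (rule loop_cases)
  ultimately have "g' = cayley_inv n F g" using inverse_unique by blast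
  thus "cayley_mult n F (cayley_inv n F g) (cayley_mult n F g h) = h"
    and "cayley_mult n F (cayley_mult n F h (cayley_inv n F g)) g = h"
    using g' h by auto
qed

section \<open>The function algebra as the dual of the loop\<close>

lemma antipode_delta:
  assumes a: "a \<in> Z2n n"
  shows "sgn_act (F a a) (delta_fun a i) = (delta (u a (i + \<sigma> a a)) :: 'k gfun)"
proof
  fix g :: "bvec \<Rightarrow> 'k"
  have "fscl (F a a) (fscl (F a a) g) = g" for g :: "bvec \<Rightarrow> 'k"
    by (auto simp: F_F[OF a a] fun_eq_iff mult.assoc[symmetric])
  \<comment> \<open>Scaling by F(a,a) is an involution, so the action moves the support of the delta
    function to F(a,a) e_a^i.\<close>
  hence "fscl (F a a) g = u a i \<longleftrightarrow> g = fscl (F a a) (u a i)" by metis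
  thus "sgn_act (F a a) (delta_fun a i) g = delta (u a (i + \<sigma> a a)) g"
    using a by (simp add: sgn_act_def delta_fun_def delta_def inverse_F fscl_F)
qed

lemma antipode_eq:
  "lin_ext n (\<lambda>a i. sgn_act (F a a) (delta_fun a i)) h
     = (\<lambda>g. if g \<in> basis_loop n then h (cayley_inv n F g) else 0)"
proof
  fix g :: "bvec \<Rightarrow> 'k"
  have sum: "lin_ext n (\<lambda>a i. sgn_act (F a a) (delta_fun a i)) h g
      = (\<Sum>a\<in>Z2n n. \<Sum>i\<in>UNIV. h (u a i) * delta (u a (i + \<sigma> a a)) g)"
    by (simp add: lin_ext_def sum_fun_apply antipode_delta)
  show "lin_ext n (\<lambda>a i. sgn_act (F a a) (delta_fun a i)) h g
      = (if g \<in> basis_loop n then h (cayley_inv n F g) else 0)"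
  proof (cases "g \<in> basis_loop n")
    case True
    then obtain b j where b: "b \<in> Z2n n" "g = u b j" by (rule loop_cases)
    \<comment> \<open>Adding \<sigma> b b is an involution on bits, so exactly one delta function in
      the sum is supported at \<open>g\<close>.\<close>
    have "j = i + \<sigma> b b \<longleftrightarrow> i = j + \<sigma> b b" for i
      by (auto simp: add.assoc bit_add_self)
    hence "h (u a i) * delta (u a (i + \<sigma> a a)) g
        = (if a = b \<and> i = j + \<sigma> b b then h (u a i) else 0)" for a i
      by (auto simp: delta_def b u_inj)
    hence "lin_ext n (\<lambda>a i. sgn_act (F a a) (delta_fun a i)) h g = h (u b (j + \<sigma> b b))"
      by (simp only: sum sum_delta_index[OF b(1)])
    thus ?thesis using b True by (simp add: u_inv)
  next
    case False
    hence "delta (u a i) g = (0::'k)" if "a \<in> Z2n n" for a i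
      using that by (auto simp: delta_def sgn_basis_loop)
    thus ?thesis using False by (simp add: sum)
  qed
qed

lemma unit_eq:
  "(\<Sum>a\<in>Z2n n. \<Sum>i\<in>UNIV. delta_fun a i) = (\<lambda>g. if g \<in> basis_loop n then 1 else (0::'k))"
proof
  fix g :: "bvec \<Rightarrow> 'k"
  show "(\<Sum>a\<in>Z2n n. \<Sum>i\<in>UNIV. delta_fun a i) g = (if g \<in> basis_loop n then 1 else 0)"
  proof (cases "g \<in> basis_loop n")
    case True
    then obtain b j where b: "b \<in> Z2n n" "g = u b j" by (rule loop_cases)
    have "delta_fun a i g = (if a = b \<and> i = j then 1 else 0)" for a i
      by (simp add: b delta_fun_apply[OF two])
    thus ?thesis using True by (simp add: sum_fun_apply sum_delta_index[OF b(1)])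
  next
    case False
    hence "delta_fun a i g = 0" if "a \<in> Z2n n" for a i
      using that by (auto simp: delta_fun_def sgn_basis_loop)
    thus ?thesis using False by (simp add: sum_fun_apply)
  qed
qed

lemma counit_eq:
  "(\<Sum>a\<in>Z2n n. \<Sum>i\<in>UNIV. h (u a i) * (if a = 0 \<and> i = 0 then 1 else 0)) = h (u 0 0)"
  for h :: "'k gfun"
proof -
  have "h (u a i) * (if a = 0 \<and> i = 0 then 1 else 0) = (if a = 0 \<and> i = 0 then h (u a i) else 0)"
    for a i by simp
  thus ?thesis by (simp only: sum_delta_index[OF zero_Z2n])
qed

text \<open>The bridge from the formulas on delta functions to the general results on loops; the
  coproduct is handled by \<open>cop_dual_product\<close>.\<close>

lemma fun_coquasi_eq:
  "fun_coquasi n F = loop_functions (basis_loop n) (cayley_mult n F) (u 0 0) (cayley_inv n F)"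
proof -
  have space: "fun_space n = supported (basis_loop n)"
    by (simp add: fun_space_def supported_def)
  have "cop (fun_coquasi n F) = cop (loop_functions (basis_loop n) (cayley_mult n F) (u 0 0) (cayley_inv n F))"
    by (rule ext) (simp add: cop_dual_product[OF two Q] loop_functions_def delta_def space)
  thus ?thesis
    by (simp add: fun_coquasi_def loop_functions_def antipode_eq[THEN ext] unit_eq counit_eq fun_space_def)
qed

section \<open>The signs as a nuclear normal subloop\<close>

lemma finite_ip_loop_basis:
  "finite_ip_loop (basis_loop n) (cayley_mult n F) (u 0 0) (cayley_inv n F) (fun_coquasi n F)"
proof
  fix x :: "bvec \<Rightarrow> 'k" assume "x \<in> basis_loop n"
  then obtain a i where "a \<in> Z2n n" "x = u a i" by (rule loop_cases)
  thus "cayley_inv n F x \<in> basis_loop n" by (simp add: u_inv sgn_basis_loop)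
qed (use Q in \<open>auto simp: finite_basis_loop fun_coquasi_eq inverse_laws quasigroup_def\<close>)

text \<open>\<open>cayley_mult 0\<close> sums only over the pair (0, 0), so the quasigroup property
  for n = 0 is not an instance of \<open>Q\<close> and is checked directly: as F(0,0) = 1, signs
  multiply by adding exponents.\<close>

lemma zero_loop: "cayley_loop 0 F"
proof
  have F: "F 0 0 = 1" using cochain zero_Z2n by (auto simp: unital_cochain_def)
  show "unital_cochain 0 F" by (simp add: unital_cochain_def Z2n_0 F)
  have mult: "cayley_mult 0 F (u 0 i) (u 0 j) = u 0 (i + j)" for i j
    by (simp add: sgn_basis_mult Z2n_0 F fun_eq_iff)
  have loop: "basis_loop 0 = range (u 0)" unfolding basis_loop_def Z2n_0 by blast
  have "\<exists>g'\<in>basis_loop 0. \<forall>h\<in>basis_loop 0.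
      cayley_mult 0 F g' (cayley_mult 0 F g h) = h \<and> cayley_mult 0 F (cayley_mult 0 F h g') g = h"
    if "g \<in> basis_loop 0" for g :: "bvec \<Rightarrow> 'k"
  \<comment> \<open>Each sign is its own inverse, since j + j = 0 for bits.\<close>
  proof (intro bexI[of _ g] ballI)
    fix h :: "bvec \<Rightarrow> 'k" assume "h \<in> basis_loop 0"
    then obtain i j where "h = u 0 i" "g = u 0 j" using \<open>g \<in> basis_loop 0\<close> by (auto simp: loop)
    thus "cayley_mult 0 F g (cayley_mult 0 F g h) = h \<and> cayley_mult 0 F (cayley_mult 0 F h g) g = h"
      by (simp only: mult add.assoc bit_add_self add.assoc[symmetric, of j j] add_0 add_0_right)
  qed (fact that)
  thus "quasigroup (basis_loop 0) (cayley_mult 0 F) (u 0 0)"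
    by (auto simp: quasigroup_def loop mult)
qed (fact two)

text \<open>A loop element is a sign exactly when its index is 0, so normality and the associator
  condition are computations with indices, while nuclearity compares sign exponents.\<close>

lemma nuclear_basis_loop_0:
  "finite_ip_loop_nuclear (basis_loop n) (cayley_mult n F) (u 0 0) (cayley_inv n F) (fun_coquasi n F)
     (basis_loop 0) (cayley_mult 0 F) (cayley_inv 0 F) (fun_coquasi 0 F)"
proof -
  interpret zero: cayley_loop 0 F by (rule zero_loop)
  interpret finite_ip_loop "basis_loop n" "cayley_mult n F" "u 0 0" "cayley_inv n F" "fun_coquasi n F"
    by (rule finite_ip_loop_basis)
  have Z: "g \<in> basis_loop 0 \<longleftrightarrow> (\<exists>i. g = u 0 i)" for g :: "bvec \<Rightarrow> 'k"
    unfolding basis_loop_def Z2n_0 by blast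
  show ?thesis
  proof (intro finite_ip_loop_nuclear.intro finite_ip_loop_nuclear_axioms.intro finite_ip_loop_axioms)
    show "basis_loop 0 \<subseteq> (basis_loop n :: (bvec \<Rightarrow> 'k) set)"
      using zero_Z2n by (auto simp: Z sgn_basis_loop)
    show "finite_ip_loop (basis_loop 0) (cayley_mult 0 F) (u 0 0) (cayley_inv 0 F) (fun_coquasi 0 F)"
      by (rule zero.finite_ip_loop_basis)
  next
    fix x y :: "bvec \<Rightarrow> 'k" assume "x \<in> basis_loop 0" "y \<in> basis_loop 0"
    thus "cayley_mult 0 F x y = cayley_mult n F x y"
      by (auto simp: Z sgn_basis_mult zero_Z2n)
  next
    fix x y z :: "bvec \<Rightarrow> 'k"
    assume "x \<in> basis_loop n" "y \<in> basis_loop n" "z \<in> basis_loop n"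
    then obtain a i b j c k where *: "a \<in> Z2n n" "b \<in> Z2n n" "c \<in> Z2n n"
      "x = u a i" "y = u b j" "z = u c k" by (metis loop_cases)
    \<comment> \<open>Both x(yz) and the inverse of (xy)z have index a + b + c, and twice this is
      0.\<close>
    show "cayley_mult n F (cayley_mult n F x (cayley_mult n F y z))
        (cayley_inv n F (cayley_mult n F (cayley_mult n F x y) z)) \<in> basis_loop 0"
      by (simp add: * u_mult u_inv Z2n_add Z add.assoc[symmetric] bvec_add_self u_inj)
    assume "x \<in> basis_loop 0 \<or> y \<in> basis_loop 0 \<or> z \<in> basis_loop 0"
    hence "a = 0 \<or> b = 0 \<or> c = 0" by (auto simp: * Z u_inj)
    \<comment> \<open>As \<sigma> vanishes when an argument is 0, each bracketing keeps at most one
      term of \<sigma>, the same for both.\<close>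
    thus "cayley_mult n F (cayley_mult n F x y) z = cayley_mult n F x (cayley_mult n F y z)"
      using * by (auto simp: u_mult Z2n_add zero_Z2n sigma_unit u_inj add_ac)
  next
    fix x y :: "bvec \<Rightarrow> 'k" assume "x \<in> basis_loop n" "y \<in> basis_loop 0"
    then obtain a i j where *: "a \<in> Z2n n" "x = u a i" "y = u 0 j"
      by (metis loop_cases Z)
    show "cayley_mult n F (cayley_mult n F x y) (cayley_inv n F x) \<in> basis_loop 0"
      using zero_Z2n by (simp add: * u_mult u_inv Z bvec_add_self u_inj)
  qed
qed

end

theorem mainTheorem2:
  fixes n :: nat and F :: "bvec \<Rightarrow> bvec \<Rightarrow> 'k::field"
  assumes char_not_2: "(1::'k) \<noteq> - 1"
    and cochain: "unital_cochain n F"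
    and loop: "quasigroup (basis_loop n) (cayley_mult n F) (sgn_basis 0 0)"
  shows "hopf_coquasigroup (fun_coquasi n F) \<and>
         quasi_coassociative (fun_coquasi 0 F) (fun_coquasi n F) restrict_proj"
proof -
  interpret cayley_loop n F using assms by unfold_locales
  interpret N: finite_ip_loop_nuclear "basis_loop n" "cayley_mult n F" "sgn_basis 0 0" "cayley_inv n F"
    "fun_coquasi n F" "basis_loop 0" "cayley_mult 0 F" "cayley_inv 0 F" "fun_coquasi 0 F"
    by (rule nuclear_basis_loop_0)
  \<comment> \<open>Both restrict to the signs and extend by 0, so the result on subloops speaks of
    the canonical projection.\<close>
  have "restrict_proj = N.res" by (intro ext) (simp add: restrict_proj_def N.res_def)
  thus ?thesis using N.hopf_coquasigroup_H N.quasi_coassociative_res by simp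
qed

end
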